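(* Let $(m_j),(n_j)$ be sequences of nonnegative integers with $m_j<n_j$, $m_j\to\infty$, and $n_j/m_j\to\lambda$ for some real $\lambda>1$. Then $$\liminf_{j\to\infty}d_{\mathrm{GH}}(\mathbb S^{m_j},\mathbb S^{n_j})\ge\Phi_\chi(\lambda).$$ If $\lambda>\lambda_*$, then $$\liminf_{j\to\infty}\left(d_{\mathrm{GH}}(\mathbb S^{m_j},\mathbb S^{n_j})-\frac12c_{m_j,n_j}\right)\ge\Phi_\chi(\lambda)-\frac\pi4>0.$$ In particular, $\tfrac12c_{m_j,n_j}<d_{\mathrm{GH}}(\mathbb S^{m_j},\mathbb S^{n_j})$ for all sufficiently large $j$. Moreover, $\lambda>\lambda_*$ whenever $\lambda\ge9$.
   Context: For $m\ge1$, $\mathbb S^m\subset\mathbb R^{m+1}$ is the unit round sphere with geodesic metric $\arccos\langle x,x'\rangle$; $\mathbb S^0$ is two points at distance $\pi$. $d_{\mathrm{GH}}$ is the Gromov--Hausdorff distance between compact metric spaces (half the infimum of distortions of correspondences). The group $C_2$ of order two acts antipodally on each sphere; a map between $C_2$-spaces is odd if it is $C_2$-equivariant. The coindex of a $C_2$-space $X$ is $\mathrm{coind}(X):=\sup\{k\ge0:\text{there is a continuous odd map }\mathbb S^k\to X\}$. For a metric space $X$ and $r\ge0$, $\mathrm{VR}(X;r)$ is the geometric realization of the simplicial complex with vertex set $X$ whose simplices are the nonempty finite subsets of diameter at most $r$; $\mathrm{VR}(\mathbb S^m;r)$ carries the $C_2$-action induced by the antipodal map. For integers $0\le m\le n$,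 $c_{m,n}:=\inf\{r\ge0:\mathrm{coind}(\mathrm{VR}(\mathbb S^m;r))\ge n\}$. For $\lambda>1$, $\Phi_\chi(\lambda):=\max_{0<x<\pi/2}\left[x-\arcsin\bigl((\sin x)^\lambda\bigr)\right]$. The function $\Phi_\chi$ is continuous and strictly increasing, and $\lambda_*>1$ denotes the unique number such that, for all $\lambda>1$, $\Phi_\chi(\lambda)>\tfrac\pi4\iff\lambda>\lambda_*$. *)

theory Defs
  imports "HOL-Analysis.Analysis"
begin

text \<open>
  Spheres are the library's \<^const>\<open>nsphere\<close>: the points of \<open>nsphere m\<close> are the functions
  \<open>nat \<Rightarrow> real\<close> supported in \<open>{..m}\<close> with \<open>\<Sum>i\<le>m. x i ^ 2 = 1\<close>.  In particular \<open>nsphere 0\<close> has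
  two points, at distance \<open>arccos (- 1) = pi\<close> in the following metric.
\<close>

definition sphere_dist :: "nat \<Rightarrow> (nat \<Rightarrow> real) \<Rightarrow> (nat \<Rightarrow> real) \<Rightarrow> real" where
  "sphere_dist m x y = arccos (\<Sum>i\<le>m. x i * y i)"

definition antipode :: "(nat \<Rightarrow> real) \<Rightarrow> nat \<Rightarrow> real" where
  "antipode x = (\<lambda>i. - x i)"

subsection \<open>Gromov--Hausdorff distance\<close>

definition correspondence :: "'a set \<Rightarrow> 'b set \<Rightarrow> ('a \<times> 'b) set \<Rightarrow> bool" where
  "correspondence X Y R \<longleftrightarrow> R \<subseteq> X \<times> Y \<and> fst ` R = X \<and> snd ` R = Y"

definition distortion ::
  "('a \<Rightarrow> 'a \<Rightarrow> real) \<Rightarrow> ('b \<Rightarrow> 'b \<Rightarrow> real) \<Rightarrow> ('a \<times> 'b) set \<Rightarrow> real" where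
  "distortion dX dY R = (SUP ((x, y), (x', y')) \<in> R \<times> R. \<bar>dX x x' - dY y y'\<bar>)"

text \<open>
  The real-valued supremum and infimum are meaningful when \<open>X\<close> and \<open>Y\<close> are nonempty and the
  distances are bounded, as for nonempty compact metric spaces.
\<close>

definition GH_dist ::
  "'a set \<Rightarrow> ('a \<Rightarrow> 'a \<Rightarrow> real) \<Rightarrow> 'b set \<Rightarrow> ('b \<Rightarrow> 'b \<Rightarrow> real) \<Rightarrow> real" where
  "GH_dist X dX Y dY = (INF R \<in> {R. correspondence X Y R}. distortion dX dY R) / 2"

definition sphere_GH_dist :: "nat \<Rightarrow> nat \<Rightarrow> real" where
  "sphere_GH_dist m n =
     GH_dist (topspace (nsphere m)) (sphere_dist m) (topspace (nsphere n)) (sphere_dist n)"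

subsection \<open>Geometric realization and Vietoris--Rips complexes\<close>

text \<open>
  A simplicial complex is given by its set \<open>K\<close> of simplices (nonempty finite vertex sets); points
  of its realization are written in barycentric coordinates, as functions on the vertex type.
\<close>

definition closed_simplex :: "'a set \<Rightarrow> ('a \<Rightarrow> real) set" where
  "closed_simplex \<sigma> = {t. (\<forall>x. 0 \<le> t x) \<and> (\<forall>x. x \<notin> \<sigma> \<longrightarrow> t x = 0) \<and> sum t \<sigma> = 1}"

text \<open>
  The topology is the weak (coherent) one.  On each closed simplex, which has only finitely many
  nonzero coordinates, the product topology is the Euclidean topology.
\<close>

definition geom_realization :: "'a set set \<Rightarrow> ('a \<Rightarrow> real) topology" where
  "geom_realization K = topology (\<lambda>U. U \<subseteq> (\<Union>\<sigma>\<in>K. closed_simplex \<sigma>) \<and>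
     (\<forall>\<sigma>\<in>K. openin (subtopology (powertop_real UNIV) (closed_simplex \<sigma>)) (U \<inter> closed_simplex \<sigma>)))"

lemma openin_geom_realization:
  "openin (geom_realization K) U \<longleftrightarrow> U \<subseteq> (\<Union>\<sigma>\<in>K. closed_simplex \<sigma>) \<and>
     (\<forall>\<sigma>\<in>K. openin (subtopology (powertop_real UNIV) (closed_simplex \<sigma>)) (U \<inter> closed_simplex \<sigma>))"
proof -
  let ?T = "\<lambda>\<sigma>. subtopology (powertop_real UNIV) (closed_simplex \<sigma>)"
  have "istopology (\<lambda>U. U \<subseteq> (\<Union>\<sigma>\<in>K. closed_simplex \<sigma>) \<and>
      (\<forall>\<sigma>\<in>K. openin (?T \<sigma>) (U \<inter> closed_simplex \<sigma>)))"
    unfolding istopology_def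
  proof (intro conjI allI impI ballI)
    fix S T \<sigma>
    assume S: "S \<subseteq> (\<Union>\<sigma>\<in>K. closed_simplex \<sigma>) \<and>
        (\<forall>\<sigma>\<in>K. openin (?T \<sigma>) (S \<inter> closed_simplex \<sigma>))"
      and T: "T \<subseteq> (\<Union>\<sigma>\<in>K. closed_simplex \<sigma>) \<and>
        (\<forall>\<sigma>\<in>K. openin (?T \<sigma>) (T \<inter> closed_simplex \<sigma>))"
    show "S \<inter> T \<subseteq> (\<Union>\<sigma>\<in>K. closed_simplex \<sigma>)" using S by blast
    assume "\<sigma> \<in> K"
    then have "openin (?T \<sigma>) ((S \<inter> closed_simplex \<sigma>) \<inter> (T \<inter> closed_simplex \<sigma>))"
      using S T by blast
    then show "openin (?T \<sigma>) (S \<inter> T \<inter> closed_simplex \<sigma>)"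
      by (simp add: Int_ac)
  next
    fix \<K> \<sigma>
    assume *: "\<forall>U\<in>\<K>. U \<subseteq> (\<Union>\<sigma>\<in>K. closed_simplex \<sigma>) \<and>
        (\<forall>\<sigma>\<in>K. openin (?T \<sigma>) (U \<inter> closed_simplex \<sigma>))"
    show "\<Union>\<K> \<subseteq> (\<Union>\<sigma>\<in>K. closed_simplex \<sigma>)" using * by blast
    assume "\<sigma> \<in> K"
    then have "openin (?T \<sigma>) (\<Union>((\<lambda>U. U \<inter> closed_simplex \<sigma>) ` \<K>))"
      using * by (intro openin_Union) auto
    moreover have "\<Union>((\<lambda>U. U \<inter> closed_simplex \<sigma>) ` \<K>) = \<Union>\<K> \<inter> closed_simplex \<sigma>" by blast
    ultimately show "openin (?T \<sigma>) (\<Union>\<K> \<inter> closed_simplex \<sigma>)" by simp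
  qed
  then show ?thesis
    by (simp add: geom_realization_def topology_inverse')
qed

definition VR_complex :: "'a set \<Rightarrow> ('a \<Rightarrow> 'a \<Rightarrow> real) \<Rightarrow> real \<Rightarrow> 'a set set" where
  "VR_complex X d r = {\<sigma>. finite \<sigma> \<and> \<sigma> \<noteq> {} \<and> \<sigma> \<subseteq> X \<and> (\<forall>x\<in>\<sigma>. \<forall>y\<in>\<sigma>. d x y \<le> r)}"

definition VR :: "'a set \<Rightarrow> ('a \<Rightarrow> 'a \<Rightarrow> real) \<Rightarrow> real \<Rightarrow> ('a \<Rightarrow> real) topology" where
  "VR X d r = geom_realization (VR_complex X d r)"

definition sphere_VR :: "nat \<Rightarrow> real \<Rightarrow> ((nat \<Rightarrow> real) \<Rightarrow> real) topology" where
  "sphere_VR m r = VR (topspace (nsphere m)) (sphere_dist m) r"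

text \<open>
  The induced simplicial action sends \<open>\<Sum>x. t x \<cdot> x\<close> to \<open>\<Sum>x. t x \<cdot> (- x)\<close>, whose coordinate
  at \<open>x\<close> is \<open>t (- x)\<close>.
\<close>

definition VR_antipode :: "((nat \<Rightarrow> real) \<Rightarrow> real) \<Rightarrow> (nat \<Rightarrow> real) \<Rightarrow> real" where
  "VR_antipode t = (\<lambda>x. t (antipode x))"

subsection \<open>Coindex\<close>

text \<open>
  A space with an action of the group of order two is given by a topology \<open>X\<close> and the action \<open>\<nu>\<close>
  of the generator.
\<close>

definition odd_map :: "nat \<Rightarrow> 'a topology \<Rightarrow> ('a \<Rightarrow> 'a) \<Rightarrow> ((nat \<Rightarrow> real) \<Rightarrow> 'a) \<Rightarrow> bool" where
  "odd_map k X \<nu> f \<longleftrightarrow> continuous_map (nsphere k) X f \<and>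
     (\<forall>x\<in>topspace (nsphere k). f (antipode x) = \<nu> (f x))"

text \<open>
  The supremum may be infinite, hence \<^typ>\<open>enat\<close>.  The index \<open>k = 0\<close> always occurs when \<open>X\<close> is
  nonempty; for the empty space the value here is \<open>0\<close>.
\<close>

definition coind :: "'a topology \<Rightarrow> ('a \<Rightarrow> 'a) \<Rightarrow> enat" where
  "coind X \<nu> = Sup {enat k | k. \<exists>f. odd_map k X \<nu> f}"

definition c_VR :: "nat \<Rightarrow> nat \<Rightarrow> real" where
  "c_VR m n = Inf {r. 0 \<le> r \<and> enat n \<le> coind (sphere_VR m r) VR_antipode}"

subsection \<open>The bound and its threshold\<close>

definition Phi_chi :: "real \<Rightarrow> real" where
  "Phi_chi l = (GREATEST y. \<exists>x. 0 < x \<and> x < pi / 2 \<and> y = x - arcsin (sin x powr l))"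

definition lambda_star :: real where
  "lambda_star = (THE s. 1 < s \<and> (\<forall>l>1. Phi_chi l > pi / 4 \<longleftrightarrow> l > s))"

end

theory Submission
  imports Defs "HOL-Real_Asymp.Real_Asymp"
begin

text \<open>
  Why the theorem holds.  The bound \<open>Phi_chi l\<close> compares the volume growth of the two spheres at
  two different scales.  A sphere of dimension \<open>m\<close> is covered by about \<open>(1 / sin y) ^ m\<close> caps of
  angular radius \<open>y\<close>, whereas a set of angular diameter \<open>2 x\<close> occupies at most about the fraction
  \<open>sin x ^ n\<close> of a sphere of dimension \<open>n\<close>.  If the Gromov--Hausdorff distance were smaller than
  \<open>x - y\<close>, a correspondence would transport the caps of the small sphere to sets of diameter at most
  \<open>2 y + 2 (x - y) = 2 x\<close> that still cover the large one, so up to subexponential factors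
  \<open>(1 / sin x) ^ n \<le> (1 / sin y) ^ m\<close>.  With \<open>n \<sim> l m\<close> this fails as soon as
  \<open>sin y > sin x powr l\<close>, which is the first claim.

  All volumes are Lebesgue volumes in the coordinate spaces \<open>lborel_on {..m}\<close>; no measure on the
  sphere is used.  Points of the sphere at angle \<open>2 x\<close> have Euclidean distance \<open>2 sin x\<close>, so a set of
  angular diameter \<open>2 x\<close> spans a thin shell piece of Euclidean diameter about \<open>2 sin x\<close>, and the
  Euclidean isodiametric inequality (\<open>isodiametric\<close>) already has the right exponential rate
  (\<open>sphere_partition_lower_bound\<close>).  That inequality follows from the
  Prekopa--Leindler inequality (\<open>prekopa_leindler\<close>) applied to a set and its reflection.

  The covering (\<open>sphere_cover_upper_bound\<close>) comes from averaging: if \<open>c\<^sup>2 + s\<^sup>2 = 1\<close>, the balls of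
  radius \<open>c\<close> about the origin and of radius \<open>s\<close> about a point of the sphere meet in a lens which,
  in high dimension, has almost the volume of a ball of radius \<open>c s\<close> (\<open>lens_volume\<close>).  Hence a
  random centre in the ball of radius \<open>c\<close> is within \<open>s\<close> of a given point of the sphere with
  probability about \<open>s ^ m\<close>, and choosing centres greedily for a finite net loses only a polynomial
  factor.

  For the second claim it remains to see that \<open>c_VR m n\<close> is asymptotically at most \<open>pi / 2\<close>
  (\<open>c_VR_asymptotic_upper_bound\<close>).  When \<open>n\<close> is only linear in \<open>m\<close>, there are \<open>n + 1\<close> nearly
  orthogonal unit vectors in dimension \<open>m + 1\<close>; together with their antipodes they span a
  cross-polytope boundary in the Vietoris--Rips complex at a scale slightly above \<open>pi / 2\<close>, and
  radial projection onto it is an odd map from the sphere of dimension \<open>n\<close>.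

  Finally, \<open>lambda_star\<close> exists because exceeding \<open>pi / 4\<close> is a monotone and open condition on the
  exponent which fails at \<open>2\<close> and holds at \<open>9\<close>; the latter is seen at the angle with sine \<open>4 / 5\<close>.
\<close>

section \<open>Midpoint sets and the Prekopa--Leindler inequality on the line\<close>

lemma emeasure_lborel_affine_vimage:
  fixes A :: "real set"
  assumes "A \<in> sets borel" "c \<noteq> 0"
  shows "emeasure lborel A = ennreal \<bar>c\<bar> * emeasure lborel {x. t + c * x \<in> A}"
proof -
  have m: "{x. t + c * x \<in> A} \<in> sets borel"
    using assms(1) by measurable
  have "emeasure lborel A = (\<integral>\<^sup>+x. indicator A x \<partial>lborel)"
    using assms(1) by simp
  also have "\<dots> = ennreal \<bar>c\<bar> * (\<integral>\<^sup>+x. indicator A (t + c * x) \<partial>lborel)"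
    using assms by (intro nn_integral_real_affine) auto
  also have "(\<integral>\<^sup>+x. indicator A (t + c * x) \<partial>lborel)
      = (\<integral>\<^sup>+x. indicator {x. t + c * x \<in> A} x \<partial>lborel)"
    by (intro nn_integral_cong) (auto simp: indicator_def)
  finally show ?thesis using m by simp
qed

text \<open>
  The one-dimensional Brunn--Minkowski inequality.  Averaging all of \<open>K\<close> with the least point of \<open>L\<close>,
  and all of \<open>L\<close> with the greatest point of \<open>K\<close>, yields two half-size copies inside \<open>C\<close> that share a
  single point.
\<close>

lemma midpoint_measure_compact:
  fixes K L C :: "real set"
  assumes "compact K" "compact L" "K \<noteq> {}" "L \<noteq> {}" "C \<in> sets borel"
    and mid: "\<And>a b. a \<in> K \<Longrightarrow> b \<in> L \<Longrightarrow> (a + b) / 2 \<in> C"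
  shows "emeasure lborel K + emeasure lborel L \<le> 2 * emeasure lborel C"
proof -
  obtain k where k: "k \<in> K" "\<And>x. x \<in> K \<Longrightarrow> x \<le> k"
    using compact_attains_sup[OF assms(1,3)] by blast
  obtain l where l: "l \<in> L" "\<And>x. x \<in> L \<Longrightarrow> l \<le> x"
    using compact_attains_inf[OF assms(2,4)] by blast
  define P where "P = {c. - l + 2 * c \<in> K}"
  define Q where "Q = {c. - k + 2 * c \<in> L}"
  have KL: "K \<in> sets borel" "L \<in> sets borel" using assms by (auto intro: borel_compact)
  have m: "P \<in> sets lborel" "Q \<in> sets lborel"
    unfolding P_def Q_def using KL by measurable
  define z where "z = (k + l) / 2"
  have int: "P \<inter> Q \<subseteq> {z}"
    unfolding P_def Q_def z_def using k(2) l(2) by fastforce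
  have sub: "P \<union> Q \<subseteq> C"
  proof
    fix c assume "c \<in> P \<union> Q"
    then show "c \<in> C"
    proof
      assume "c \<in> P" then show ?thesis using mid[of "- l + 2 * c" l] l(1) by (simp add: P_def)
    next
      assume "c \<in> Q" then show ?thesis using mid[of k "- k + 2 * c"] k(1) by (simp add: Q_def)
    qed
  qed
  have "emeasure lborel Q = emeasure lborel (Q - {z})"
    by (rule emeasure_Diff_null_set[symmetric]) (use m in auto)
  then have "emeasure lborel P + emeasure lborel Q = emeasure lborel P + emeasure lborel (Q - {z})"
    by simp
  also have "\<dots> = emeasure lborel (P \<union> (Q - {z}))"
    using m int by (intro plus_emeasure) auto
  also have "\<dots> \<le> emeasure lborel C"
    using sub assms(5) by (intro emeasure_mono) auto
  finally have le: "emeasure lborel P + emeasure lborel Q \<le> emeasure lborel C" .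
  have "emeasure lborel K = 2 * emeasure lborel P"
    using emeasure_lborel_affine_vimage[OF KL(1), of 2 "-l"] unfolding P_def by simp
  moreover have "emeasure lborel L = 2 * emeasure lborel Q"
    using emeasure_lborel_affine_vimage[OF KL(2), of 2 "-k"] unfolding Q_def by simp
  ultimately show ?thesis
    using mult_left_mono[OF le, of 2] by (simp add: distrib_left)
qed

text \<open>
  Inner regularity, with nonempty compact sets: extremal points are needed even for null sets.
\<close>

lemma compact_exhaustion:
  fixes A :: "real set"
  assumes "A \<in> sets borel" "A \<noteq> {}"
  obtains K :: "nat \<Rightarrow> real set" where "\<And>n. compact (K n)" "\<And>n. K n \<noteq> {}" "\<And>n. K n \<subseteq> A"
    "(\<lambda>n. emeasure lborel (K n)) \<longlonglongrightarrow> emeasure lborel A"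
proof -
  obtain a where a: "a \<in> A" using assms by blast
  obtain N and C :: "nat \<Rightarrow> real set" where NC: "negligible N" "\<And>n. compact (C n)" "A = (\<Union>n. C n) \<union> N"
    using lebesgue_regular_inner[of A] assms(1) by auto
  define K where "K n = insert a (\<Union>i\<le>n. C i)" for n
  have c: "compact (K n)" for n
    unfolding K_def using NC(2) by (simp add: compact_UN)
  have Km: "K n \<in> sets lborel" for n using c by (simp add: borel_compact)
  have inc: "incseq K" unfolding K_def incseq_def by (auto intro: order_trans)
  have "(\<lambda>n. emeasure lborel (K n)) \<longlonglongrightarrow> emeasure lborel (\<Union>n. K n)"
    using Km inc by (intro Lim_emeasure_incseq) auto
  moreover have "emeasure lborel (\<Union>n. K n) = emeasure lborel A"
  proof -
    have sub: "(\<Union>n. K n) \<subseteq> A" using a NC(3) by (auto simp: K_def)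
    have U: "(\<Union>n. K n) \<in> sets lborel" using Km by blast
    have "A - (\<Union>n. K n) \<subseteq> N" using NC(3) by (auto simp: K_def)
    then have "negligible (A - (\<Union>n. K n))" using NC(1) negligible_subset by blast
    then have "emeasure lborel (A - (\<Union>n. K n)) = 0"
      using U assms(1) by (auto simp: negligible_iff_emeasure0)
    moreover have "emeasure lborel A = emeasure lborel (\<Union>n. K n) + emeasure lborel (A - (\<Union>n. K n))"
      using sub U assms(1) by (subst plus_emeasure) (auto simp: Un_absorb1)
    ultimately show ?thesis by simp
  qed
  ultimately have "(\<lambda>n. emeasure lborel (K n)) \<longlonglongrightarrow> emeasure lborel A" by simp
  then show ?thesis using that[of K] c a NC(3) by (auto simp: K_def)
qed

lemma midpoint_measure:
  fixes A B C :: "real set"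
  assumes "A \<in> sets borel" "B \<in> sets borel" "C \<in> sets borel" "A \<noteq> {}" "B \<noteq> {}"
    and mid: "\<And>a b. a \<in> A \<Longrightarrow> b \<in> B \<Longrightarrow> (a + b) / 2 \<in> C"
  shows "emeasure lborel A + emeasure lborel B \<le> 2 * emeasure lborel C"
proof -
  obtain K where K: "\<And>n::nat. compact (K n)" "\<And>n. K n \<noteq> {}" "\<And>n. K n \<subseteq> A"
    "(\<lambda>n. emeasure lborel (K n)) \<longlonglongrightarrow> emeasure lborel A"
    using compact_exhaustion[OF assms(1,4)] by blast
  obtain L where L: "\<And>n::nat. compact (L n)" "\<And>n. L n \<noteq> {}" "\<And>n. L n \<subseteq> B"
    "(\<lambda>n. emeasure lborel (L n)) \<longlonglongrightarrow> emeasure lborel B"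
    using compact_exhaustion[OF assms(2,5)] by blast
  have "emeasure lborel (K n) + emeasure lborel (L n) \<le> 2 * emeasure lborel C" for n
    using K L mid assms(3) by (intro midpoint_measure_compact) (auto, blast)
  moreover have "(\<lambda>n. emeasure lborel (K n) + emeasure lborel (L n))
      \<longlonglongrightarrow> emeasure lborel A + emeasure lborel B"
    using K(4) L(4) by (intro tendsto_add)
  ultimately show ?thesis by (meson LIMSEQ_le_const2)
qed

lemma nn_integral_layer_cake:
  fixes f :: "real \<Rightarrow> ennreal"
  assumes [measurable]: "f \<in> borel_measurable borel"
  shows "(\<integral>\<^sup>+x. f x \<partial>lborel)
    = (\<integral>\<^sup>+t. indicator {0<..} t * emeasure lborel {x. ennreal t < f x} \<partial>lborel)"
proof -
  have pt: "e = (\<integral>\<^sup>+t. indicator {0<..} t * indicator {t. ennreal t < e} t \<partial>lborel)" for e :: ennreal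
  proof -
    have s: "{t::real. 0 < t \<and> ennreal t < e} = (if e = top then {0<..} else {0<..<enn2real e})"
      by (cases e) (auto simp: ennreal_less_iff less_top[symmetric])
    have inf: "emeasure lborel {0::real<..} = \<infinity>"
    proof (rule ccontr)
      assume "emeasure lborel {0::real<..} \<noteq> \<infinity>"
      then obtain r where r: "emeasure lborel {0::real<..} = ennreal r" "r \<ge> 0" by (metis ennreal_cases infinity_ennreal_def)
      have "emeasure lborel {0<..<r+1} \<le> emeasure lborel {0::real<..}"
        by (intro emeasure_mono) auto
      then show False using r by simp
    qed
    have "(\<integral>\<^sup>+t. indicator {0<..} t * indicator {t. ennreal t < e} t \<partial>lborel)
        = (\<integral>\<^sup>+t. indicator {t::real. 0 < t \<and> ennreal t < e} t \<partial>lborel)"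
      by (intro nn_integral_cong) (auto simp: indicator_def)
    also have "\<dots> = emeasure lborel {t::real. 0 < t \<and> ennreal t < e}"
      by (rule nn_integral_indicator) (simp add: s)
    also have "\<dots> = e" using inf unfolding s by (cases e) auto
    finally show ?thesis by simp
  qed
  have "(\<integral>\<^sup>+x. f x \<partial>lborel)
      = (\<integral>\<^sup>+x. (\<integral>\<^sup>+t. indicator {0<..} t * indicator {t. ennreal t < f x} t \<partial>lborel) \<partial>lborel)"
    using pt by (intro nn_integral_cong) blast
  also have "\<dots> = (\<integral>\<^sup>+t. (\<integral>\<^sup>+x. indicator {0<..} t * indicator {t. ennreal t < f x} t \<partial>lborel) \<partial>lborel)"
    by (rule lborel_pair.Fubini'[symmetric]) measurable
  also have "\<dots> = (\<integral>\<^sup>+t. indicator {0<..} t * emeasure lborel {x. ennreal t < f x} \<partial>lborel)"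
  proof (intro nn_integral_cong)
    fix t :: real
    have "(\<integral>\<^sup>+x. indicator {0<..} t * indicator {t. ennreal t < f x} t \<partial>lborel)
       = (\<integral>\<^sup>+x. indicator {0<..} t * indicator {x. ennreal t < f x} x \<partial>lborel)"
      by (intro nn_integral_cong) (auto simp: indicator_def)
    also have "\<dots> = indicator {0<..} t * emeasure lborel {x. ennreal t < f x}"
      by (subst nn_integral_cmult) auto
    finally show "(\<integral>\<^sup>+x. indicator {0<..} t * indicator {t. ennreal t < f x} t \<partial>lborel)
      = indicator {0<..} t * emeasure lborel {x. ennreal t < f x}" .
  qed
  finally show ?thesis .
qed

text \<open>
  When both functions have supremum one, all superlevel sets at heights below one are nonempty, so
  the midpoint inequality for sets can be integrated over the height.
\<close>

lemma prekopa_leindler_normalized: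
  fixes f g h :: "real \<Rightarrow> ennreal"
  assumes [measurable]: "f \<in> borel_measurable borel" "g \<in> borel_measurable borel" "h \<in> borel_measurable borel"
    and le1: "\<And>x. f x \<le> 1" "\<And>x. g x \<le> 1"
    and sup1: "\<And>t. t < 1 \<Longrightarrow> \<exists>x. t < f x" "\<And>t. t < 1 \<Longrightarrow> \<exists>x. t < g x"
    and mid: "\<And>x y. f x * g y \<le> (h ((x + y) / 2))\<^sup>2"
  shows "(\<integral>\<^sup>+x. f x \<partial>lborel) + (\<integral>\<^sup>+x. g x \<partial>lborel) \<le> 2 * (\<integral>\<^sup>+x. h x \<partial>lborel)"
proof -
  let ?F = "\<lambda>f (t::real). indicator {0<..} t * emeasure lborel {x::real. ennreal t < f x} :: ennreal"
  have lc: "?F f t + ?F g t \<le> 2 * ?F h t" for t :: real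
  proof (cases "0 < t \<and> t < 1")
    case True
    then have t1: "ennreal t < 1" by (simp add: ennreal_less_one_iff)
    have "emeasure lborel {x. ennreal t < f x} + emeasure lborel {x. ennreal t < g x}
        \<le> 2 * emeasure lborel {x. ennreal t < h x}"
    proof (rule midpoint_measure)
      fix a b assume "a \<in> {x. ennreal t < f x}" "b \<in> {x. ennreal t < g x}"
      then have ab: "ennreal t < f a" "ennreal t < g b" by auto
      have "ennreal t * ennreal t < ennreal t * g b"
        using ab(2) True by (intro ennreal_mult_strict_left_mono) auto
      also have "\<dots> \<le> f a * g b"
        using ab(1) by (intro mult_right_mono) auto
      also have "\<dots> \<le> (h ((a + b) / 2))\<^sup>2" by (rule mid)
      finally have "ennreal t * ennreal t < h ((a + b) / 2) * h ((a + b) / 2)"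
        by (simp add: power2_eq_square)
      then have "ennreal t < h ((a + b) / 2)"
        by (meson mult_mono not_le zero_le)
      then show "(a + b) / 2 \<in> {x. ennreal t < h x}" by simp
    qed (use sup1[OF t1] in auto)
    then show ?thesis using True by simp
  next
    case False
    have "\<not> ennreal t < f x" "\<not> ennreal t < g x" if "t \<ge> 1" for x
      using that le1[of x] by (meson ennreal_ge_1 leD order.trans)+
    then show ?thesis using False by (auto simp: indicator_def)
  qed
  have "(\<integral>\<^sup>+x. f x \<partial>lborel) + (\<integral>\<^sup>+x. g x \<partial>lborel) = (\<integral>\<^sup>+t. ?F f t + ?F g t \<partial>lborel)"
    unfolding nn_integral_layer_cake[OF assms(1)] nn_integral_layer_cake[OF assms(2)]
    by (rule nn_integral_add[symmetric]) auto
  also have "\<dots> \<le> (\<integral>\<^sup>+t. 2 * ?F h t \<partial>lborel)"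
    using lc by (intro nn_integral_mono)
  also have "\<dots> = 2 * (\<integral>\<^sup>+x. h x \<partial>lborel)"
    unfolding nn_integral_layer_cake[OF assms(3)] by (rule nn_integral_cmult) auto
  finally show ?thesis .
qed

text \<open>
  Dividing by the suprema reduces to the normalized case, whose additive conclusion becomes
  multiplicative by the inequality between the arithmetic and the geometric mean.
\<close>

lemma prekopa_leindler_bounded:
  fixes f g h :: "real \<Rightarrow> ennreal" and k :: real
  assumes [measurable]: "f \<in> borel_measurable borel" "g \<in> borel_measurable borel" "h \<in> borel_measurable borel"
    and bd: "\<And>x. f x \<le> ennreal k" "\<And>x. g x \<le> ennreal k"
    and mid: "\<And>x y. f x * g y \<le> (h ((x + y) / 2))\<^sup>2"
  shows "(\<integral>\<^sup>+x. f x \<partial>lborel) * (\<integral>\<^sup>+x. g x \<partial>lborel) \<le> (\<integral>\<^sup>+x. h x \<partial>lborel)\<^sup>2"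
proof -
  define a where "a = (SUP x. f x)"
  define b where "b = (SUP x. g x)"
  have ab: "a \<le> ennreal k" "b \<le> ennreal k" unfolding a_def b_def using bd by (auto intro: SUP_least)
  then obtain \<alpha> \<beta> where al: "a = ennreal \<alpha>" "\<alpha> \<ge> 0" "b = ennreal \<beta>" "\<beta> \<ge> 0"
    by (metis ennreal_cases ennreal_neq_top neq_top_trans)
  have fa: "f x \<le> ennreal \<alpha>" "g x \<le> ennreal \<beta>" for x
    using al unfolding a_def b_def by (metis SUP_upper UNIV_I)+
  show ?thesis
  proof (cases "\<alpha> = 0 \<or> \<beta> = 0")
    case True
    then have "(\<forall>x. f x = 0) \<or> (\<forall>x. g x = 0)" using fa by auto
    then show ?thesis by auto
  next
    case False
    then have pos: "\<alpha> > 0" "\<beta> > 0" using al by auto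
    let ?s = "sqrt (\<alpha> * \<beta>)"
    have s: "?s > 0" using pos by simp
    have "(\<integral>\<^sup>+x. ennreal (1/\<alpha>) * f x \<partial>lborel) + (\<integral>\<^sup>+x. ennreal (1/\<beta>) * g x \<partial>lborel)
       \<le> 2 * (\<integral>\<^sup>+x. ennreal (1 / ?s) * h x \<partial>lborel)"
    proof (rule prekopa_leindler_normalized)
      fix x y
      show "ennreal (1/\<alpha>) * f x \<le> 1"
        using mult_left_mono[OF fa(1), of "ennreal (1/\<alpha>)" x] pos by (simp flip: ennreal_mult)
      show "ennreal (1/\<beta>) * g x \<le> 1"
        using mult_left_mono[OF fa(2), of "ennreal (1/\<beta>)" x] pos by (simp flip: ennreal_mult)
      have "ennreal (1/\<alpha>) * f x * (ennreal (1/\<beta>) * g y)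
          = ennreal (1/\<alpha>) * ennreal (1/\<beta>) * (f x * g y)" by (simp add: ac_simps)
      also have "ennreal (1/\<alpha>) * ennreal (1/\<beta>) = (ennreal (1 / ?s))\<^sup>2"
        using pos by (simp add: ennreal_power power_divide flip: ennreal_mult)
      also have "(ennreal (1 / ?s))\<^sup>2 * (f x * g y) \<le> (ennreal (1 / ?s))\<^sup>2 * (h ((x + y) / 2))\<^sup>2"
        using mid by (intro mult_left_mono) auto
      also have "\<dots> = (ennreal (1 / ?s) * h ((x + y) / 2))\<^sup>2" by (simp add: power_mult_distrib)
      finally show "ennreal (1/\<alpha>) * f x * (ennreal (1/\<beta>) * g y) \<le> (ennreal (1 / ?s) * h ((x + y) / 2))\<^sup>2" .
    next
      have aux: "\<exists>x. t < ennreal (1/\<gamma>) * u x" if "t < 1" "(SUP x. u x) = ennreal \<gamma>" "\<gamma> > 0"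
        for t :: ennreal and \<gamma> and u :: "real \<Rightarrow> ennreal"
      proof -
        have "t \<noteq> top" using that(1) by auto
        then obtain r where r: "t = ennreal r" "r \<ge> 0" by (cases t) auto
        then have r1: "r < 1" using that(1) by (simp add: ennreal_less_one_iff)
        have "ennreal (r * \<gamma>) < (SUP x. u x)"
          using that(2,3) r r1 by (simp add: ennreal_less_iff)
        then obtain x where x: "ennreal (r * \<gamma>) < u x" by (auto simp: less_SUP_iff)
        have "ennreal (1/\<gamma>) * ennreal (r * \<gamma>) < ennreal (1/\<gamma>) * u x"
          using x that(3) by (intro ennreal_mult_strict_left_mono) auto
        moreover have "ennreal (1/\<gamma>) * ennreal (r * \<gamma>) = t"
          using that(3) r by (simp flip: ennreal_mult)
        ultimately show ?thesis by metis
      qed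
      show "\<exists>x. t < ennreal (1/\<alpha>) * f x" if "t < 1" for t
        using aux[OF that _ pos(1), of f] al by (simp add: a_def)
      show "\<exists>x. t < ennreal (1/\<beta>) * g x" if "t < 1" for t
        using aux[OF that _ pos(2), of g] al by (simp add: b_def)
    qed measurable
    then have ineq: "ennreal (1/\<alpha>) * (\<integral>\<^sup>+x. f x \<partial>lborel) + ennreal (1/\<beta>) * (\<integral>\<^sup>+x. g x \<partial>lborel)
        \<le> 2 * (ennreal (1 / ?s) * (\<integral>\<^sup>+x. h x \<partial>lborel))"
      by (simp add: nn_integral_cmult)
    show ?thesis
    proof (cases "(\<integral>\<^sup>+x. h x \<partial>lborel) = top")
      case True then show ?thesis by (simp add: power2_eq_square ennreal_top_mult)
    next
      case False
      then obtain H where H: "(\<integral>\<^sup>+x. h x \<partial>lborel) = ennreal H" "H \<ge> 0" by (metis ennreal_cases)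
      have R: "2 * (ennreal (1 / ?s) * ennreal H) = ennreal (2 * H / ?s)"
        using H(2) s pos by (simp flip: ennreal_mult ennreal_numeral)
      have "(\<integral>\<^sup>+x. f x \<partial>lborel) \<noteq> top" "(\<integral>\<^sup>+x. g x \<partial>lborel) \<noteq> top"
        using ineq pos unfolding H(1) R by (auto simp: ennreal_mult_top top_unique)
      then obtain F G where FG: "(\<integral>\<^sup>+x. f x \<partial>lborel) = ennreal F" "F \<ge> 0"
         "(\<integral>\<^sup>+x. g x \<partial>lborel) = ennreal G" "G \<ge> 0" by (metis ennreal_cases)
      have "ennreal (F/\<alpha> + G/\<beta>) \<le> ennreal (2 * H / ?s)"
        using ineq pos FG(2,4) unfolding H(1) R FG(1,3) by (simp flip: ennreal_mult ennreal_plus)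
      then have "F/\<alpha> + G/\<beta> \<le> 2 * H / ?s" using H(2) s by (subst (asm) ennreal_le_iff) auto
      moreover have "0 \<le> F/\<alpha> + G/\<beta>" using FG pos by simp
      ultimately have "(F/\<alpha> + G/\<beta>)\<^sup>2 \<le> (2 * H / ?s)\<^sup>2" by (intro power_mono)
      also have "\<dots> = 4 * H\<^sup>2 / (\<alpha> * \<beta>)" using pos by (simp add: power_divide power_mult_distrib)
      finally have "(F/\<alpha> + G/\<beta>)\<^sup>2 \<le> 4 * H\<^sup>2 / (\<alpha> * \<beta>)" .
      moreover have "4 * (F/\<alpha>) * (G/\<beta>) \<le> (F/\<alpha> + G/\<beta>)\<^sup>2"
      proof -
        have "4 * u * v \<le> (u + v)\<^sup>2" for u v :: real
          using zero_le_power2[of "u - v"] by (simp add: power2_eq_square algebra_simps)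
        then show ?thesis .
      qed
      ultimately have "4 * (F * G) / (\<alpha> * \<beta>) \<le> 4 * H\<^sup>2 / (\<alpha> * \<beta>)" by simp
      then have "F * G \<le> H\<^sup>2" using pos by (simp add: divide_le_cancel)
      then show ?thesis using FG H by (simp add: ennreal_power flip: ennreal_mult)
    qed
  qed
qed

lemma prekopa_leindler_real:
  fixes f g h :: "real \<Rightarrow> ennreal"
  assumes [measurable]: "f \<in> borel_measurable borel" "g \<in> borel_measurable borel" "h \<in> borel_measurable borel"
    and mid: "\<And>x y. f x * g y \<le> (h ((x + y) / 2))\<^sup>2"
  shows "(\<integral>\<^sup>+x. f x \<partial>lborel) * (\<integral>\<^sup>+x. g x \<partial>lborel) \<le> (\<integral>\<^sup>+x. h x \<partial>lborel)\<^sup>2"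
proof -
  have trunc: "(\<integral>\<^sup>+x. u x \<partial>lborel) = (SUP k::nat. \<integral>\<^sup>+x. min (u x) (of_nat k) \<partial>lborel)"
    if [measurable]: "u \<in> borel_measurable borel" for u :: "real \<Rightarrow> ennreal"
  proof -
    have "(SUP k::nat. min (u x) (of_nat k)) = u x" for x
    proof -
      have "(SUP k::nat. min (u x) (of_nat k)) = min (u x) (SUP k::nat. of_nat k)"
        unfolding inf_min[symmetric] by (rule inf_SUP[symmetric])
      then show ?thesis by (simp add: ennreal_SUP_of_nat_eq_top)
    qed
    then have "(\<integral>\<^sup>+x. u x \<partial>lborel) = (\<integral>\<^sup>+x. (SUP k::nat. min (u x) (of_nat k)) \<partial>lborel)" by simp
    also have "\<dots> = (SUP k::nat. \<integral>\<^sup>+x. min (u x) (of_nat k) \<partial>lborel)"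
      by (intro nn_integral_monotone_convergence_SUP)
         (auto simp: incseq_def le_fun_def min.coboundedI2 intro!: min.mono)
    finally show ?thesis .
  qed
  have step: "(\<integral>\<^sup>+x. min (f x) (of_nat j) \<partial>lborel) * (\<integral>\<^sup>+x. min (g x) (of_nat k) \<partial>lborel)
      \<le> (\<integral>\<^sup>+x. h x \<partial>lborel)\<^sup>2" for j k :: nat
  proof (rule prekopa_leindler_bounded[where k = "real (max j k)"])
    fix x y
    show "min (f x) (of_nat j) \<le> ennreal (real (max j k))"
      by (rule min.coboundedI2) (simp flip: ennreal_of_nat_eq_real_of_nat)
    show "min (g x) (of_nat k) \<le> ennreal (real (max j k))"
      by (rule min.coboundedI2) (simp flip: ennreal_of_nat_eq_real_of_nat)
    have "min (f x) (of_nat j) * min (g y) (of_nat k) \<le> f x * g y"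
      by (intro mult_mono) auto
    then show "min (f x) (of_nat j) * min (g y) (of_nat k) \<le> (h ((x + y) / 2))\<^sup>2"
      using mid order_trans by blast
  qed measurable
  have "(SUP j::nat. \<integral>\<^sup>+x. min (f x) (of_nat j) \<partial>lborel) * (\<integral>\<^sup>+x. min (g x) (of_nat k) \<partial>lborel)
      \<le> (\<integral>\<^sup>+x. h x \<partial>lborel)\<^sup>2" for k :: nat
    using step by (simp add: SUP_mult_right_ennreal SUP_le_iff)
  then have "(\<integral>\<^sup>+x. f x \<partial>lborel) * (SUP k::nat. \<integral>\<^sup>+x. min (g x) (of_nat k) \<partial>lborel)
      \<le> (\<integral>\<^sup>+x. h x \<partial>lborel)\<^sup>2"
    unfolding trunc[OF assms(1), symmetric]
    by (simp add: SUP_mult_left_ennreal SUP_le_iff)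
  then show ?thesis unfolding trunc[OF assms(2), symmetric] .
qed

section \<open>Volume in coordinate space\<close>

abbreviation lborel_on :: "'i set \<Rightarrow> ('i \<Rightarrow> real) measure" where
  "lborel_on I \<equiv> Pi\<^sub>M I (\<lambda>_. lborel)"

lemma product_sigma_finite_lborel: "product_sigma_finite (\<lambda>_. lborel :: real measure)"
  by standard

text \<open>
  The squared form avoids square roots of extended reals.  It passes to products because the
  marginals over one coordinate satisfy the same hypothesis by induction.
\<close>

lemma prekopa_leindler:
  fixes f g h :: "('i \<Rightarrow> real) \<Rightarrow> ennreal"
  assumes "finite I"
    and "f \<in> borel_measurable (lborel_on I)" "g \<in> borel_measurable (lborel_on I)"
      "h \<in> borel_measurable (lborel_on I)"
    and "\<And>x y. f x * g y \<le> (h (\<lambda>i\<in>I. (x i + y i) / 2))\<^sup>2"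
  shows "(\<integral>\<^sup>+x. f x \<partial>lborel_on I) * (\<integral>\<^sup>+x. g x \<partial>lborel_on I) \<le> (\<integral>\<^sup>+x. h x \<partial>lborel_on I)\<^sup>2"
  using assms
proof (induction I arbitrary: f g h rule: finite_induct)
  case empty
  have "restrict u {} = (\<lambda>_. undefined)" for u :: "'i \<Rightarrow> real" by auto
  then show ?case
    using empty(4)[of "\<lambda>_. undefined" "\<lambda>_. undefined"]
    by (simp add: product_sigma_finite.nn_integral_empty[OF product_sigma_finite_lborel])
next
  case (insert i I)
  interpret product_sigma_finite "\<lambda>_::'i. lborel :: real measure"
    by (rule product_sigma_finite_lborel)
  interpret S: sigma_finite_measure "lborel_on I" by (rule sigma_finite) (rule insert(1))
  have slice: "(\<lambda>x. u (x(i := s))) \<in> borel_measurable (lborel_on I)"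
    "(\<lambda>s. \<integral>\<^sup>+x. u (x(i := s)) \<partial>lborel_on I) \<in> borel_measurable borel"
    if u: "u \<in> borel_measurable (lborel_on (insert i I))" for u :: "('i \<Rightarrow> real) \<Rightarrow> ennreal" and s
  proof -
    have add: "(\<lambda>(f, y). f(i := y)) \<in> measurable (lborel_on I \<Otimes>\<^sub>M lborel) (lborel_on (insert i I))"
      by (rule measurable_add_dim)
    have "(\<lambda>(s, x). (x, s)) \<in> measurable (lborel \<Otimes>\<^sub>M lborel_on I) (lborel_on I \<Otimes>\<^sub>M lborel)"
      by measurable
    from measurable_compose[OF measurable_compose[OF this add] u]
    have m: "(\<lambda>(s, x). u (x(i := s))) \<in> borel_measurable (lborel \<Otimes>\<^sub>M lborel_on I)"
      by (simp add: case_prod_beta)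
    from S.borel_measurable_nn_integral[OF m]
    show "(\<lambda>s. \<integral>\<^sup>+x. u (x(i := s)) \<partial>lborel_on I) \<in> borel_measurable borel" by simp
    have "(\<lambda>x. (s, x)) \<in> measurable (lborel_on I) (lborel \<Otimes>\<^sub>M lborel_on I)" by measurable
    from measurable_compose[OF this m]
    show "(\<lambda>x. u (x(i := s))) \<in> borel_measurable (lborel_on I)" by simp
  qed
  have mid: "(\<integral>\<^sup>+x. f (x(i := s)) \<partial>lborel_on I) * (\<integral>\<^sup>+x. g (x(i := t)) \<partial>lborel_on I)
      \<le> (\<integral>\<^sup>+x. h (x(i := (s + t) / 2)) \<partial>lborel_on I)\<^sup>2" for s t
  proof (rule insert.IH)
    fix x y
    have "(\<lambda>k\<in>insert i I. ((x(i := s)) k + (y(i := t)) k) / 2)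
        = (\<lambda>k\<in>I. (x k + y k) / 2)(i := (s + t) / 2)"
      using insert(2) by (auto simp: restrict_def fun_eq_iff)
    then show "f (x(i := s)) * g (y(i := t)) \<le> (h ((\<lambda>k\<in>I. (x k + y k) / 2)(i := (s + t) / 2)))\<^sup>2"
      using insert.prems(4)[of "x(i := s)" "y(i := t)"] by (simp only:)
  qed (rule slice insert.prems)+
  show ?case
    using insert.prems mid slice(2) insert(1,2)
    by (simp add: product_nn_integral_insert_rev prekopa_leindler_real)
qed

text \<open>
  Affine images of boxes are boxes, and boxes determine the product measure.
\<close>

lemma emeasure_lborel_on_affine:
  fixes c :: "'i \<Rightarrow> real" and r :: real
  assumes I: "finite I" and A: "A \<in> sets (lborel_on I)" and "r \<noteq> 0"
  shows "emeasure (lborel_on I) A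
    = ennreal (\<bar>r\<bar> ^ card I) * emeasure (lborel_on I) {x \<in> space (lborel_on I). (\<lambda>i\<in>I. c i + r * x i) \<in> A}"
proof -
  interpret product_sigma_finite "\<lambda>_::'i. lborel :: real measure"
    by (rule product_sigma_finite_lborel)
  let ?T = "\<lambda>x. \<lambda>i\<in>I. c i + r * x i"
  have T: "?T \<in> measurable (lborel_on I) (lborel_on I)"
    by measurable
  let ?P = "scale_measure (ennreal (\<bar>r\<bar> ^ card I)) (distr (lborel_on I) (lborel_on I) ?T)"
  have "?P = lborel_on I"
  proof (rule PiM_eqI[OF I])
    fix B :: "'i \<Rightarrow> real set" assume "\<And>i. i \<in> I \<Longrightarrow> B i \<in> sets lborel"
    then have B: "\<And>i. i \<in> I \<Longrightarrow> B i \<in> sets borel" by simp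
    have pre: "?T -` Pi\<^sub>E I B \<inter> space (lborel_on I) = Pi\<^sub>E I (\<lambda>i. {x. c i + r * x \<in> B i})"
      by (auto simp: space_PiM PiE_def Pi_def extensional_def)
    have m: "{x. c i + r * x \<in> B i} \<in> sets lborel" if "i \<in> I" for i
      using B[OF that] by measurable
    have "emeasure ?P (Pi\<^sub>E I B)
        = ennreal (\<bar>r\<bar> ^ card I) * emeasure (lborel_on I) (Pi\<^sub>E I (\<lambda>i. {x. c i + r * x \<in> B i}))"
      using T B I by (simp add: emeasure_distr pre sets_PiM_I_finite)
    also have "\<dots> = (\<Prod>i\<in>I. ennreal \<bar>r\<bar>) * (\<Prod>i\<in>I. emeasure lborel {x. c i + r * x \<in> B i})"
      using m I by (subst emeasure_PiM) (auto simp: ennreal_power)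
    also have "\<dots> = (\<Prod>i\<in>I. emeasure lborel (B i))"
      unfolding prod.distrib[symmetric]
      using emeasure_lborel_affine_vimage[OF B \<open>r \<noteq> 0\<close>] by (intro prod.cong) auto
    finally show "emeasure ?P (Pi\<^sub>E I B) = (\<Prod>i\<in>I. emeasure lborel (B i))" .
  qed simp
  then have "emeasure (lborel_on I) A = emeasure ?P A" by simp
  also have "\<dots> = ennreal (\<bar>r\<bar> ^ card I) * emeasure (lborel_on I) (?T -` A \<inter> space (lborel_on I))"
    using T A by (simp add: emeasure_distr)
  also have "?T -` A \<inter> space (lborel_on I) = {x \<in> space (lborel_on I). ?T x \<in> A}" by auto
  finally show ?thesis .
qed

text \<open>
  Points are functions on \<open>I\<close>; values outside \<open>I\<close> are ignored, so that extensional functions and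
  points of \<^const>\<open>nsphere\<close>, which vanish outside, can be compared directly.
\<close>

definition edist :: "'i set \<Rightarrow> ('i \<Rightarrow> real) \<Rightarrow> ('i \<Rightarrow> real) \<Rightarrow> real" where
  "edist I x y = L2_set (\<lambda>i. x i - y i) I"

definition ecball :: "'i set \<Rightarrow> ('i \<Rightarrow> real) \<Rightarrow> real \<Rightarrow> ('i \<Rightarrow> real) set" where
  "ecball I c r = {x \<in> space (lborel_on I). edist I x c \<le> r}"

definition unit_ball_volume :: "'i set \<Rightarrow> real" where
  "unit_ball_volume I = measure (lborel_on I) (ecball I (\<lambda>_. 0) 1)"

lemma edist_measurable [measurable]:
  "finite I \<Longrightarrow> (\<lambda>x. edist I x c) \<in> borel_measurable (lborel_on I)"
  unfolding edist_def L2_set_def by measurable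

lemma ecball_sets [measurable]: "finite I \<Longrightarrow> ecball I c r \<in> sets (lborel_on I)"
  unfolding ecball_def by measurable

lemma edist_nonneg: "0 \<le> edist I x y"
  by (simp add: edist_def)

lemma edist_commute: "edist I x y = edist I y x"
  by (simp add: edist_def L2_set_def power2_commute)

lemma edist_triangle: "edist I x z \<le> edist I x y + edist I y z"
  using L2_set_triangle_ineq[of "\<lambda>i. x i - y i" "\<lambda>i. y i - z i" I] by (simp add: edist_def)

lemma edist_cong: "(\<And>i. i \<in> I \<Longrightarrow> x i = x' i) \<Longrightarrow> (\<And>i. i \<in> I \<Longrightarrow> y i = y' i) \<Longrightarrow> edist I x y = edist I x' y'"
  unfolding edist_def by (rule L2_set_cong) auto

lemma edist_le_iff: "0 \<le> r \<Longrightarrow> edist I x y \<le> r \<longleftrightarrow> (\<Sum>i\<in>I. (x i - y i)\<^sup>2) \<le> r\<^sup>2"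
  unfolding edist_def L2_set_def by (metis abs_of_nonneg real_sqrt_abs real_sqrt_le_iff)

lemma edist_square: "(edist I x y)\<^sup>2 = (\<Sum>i\<in>I. (x i - y i)\<^sup>2)"
  unfolding edist_def L2_set_def by (simp add: sum_nonneg)

lemma edist_le_coord:
  assumes "finite I" "\<And>i. i \<in> I \<Longrightarrow> \<bar>x i - y i\<bar> \<le> e" "0 \<le> e"
  shows "edist I x y \<le> sqrt (card I) * e"
proof -
  have "(\<Sum>i\<in>I. (x i - y i)\<^sup>2) \<le> (\<Sum>i\<in>I. e\<^sup>2)"
    by (intro sum_mono abs_le_square_iff[THEN iffD1]) (use assms in auto)
  then show ?thesis using assms(3) by (subst edist_le_iff) (auto simp: power_mult_distrib)
qed

lemma unit_ball_volume:
  fixes I :: "'i set"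
  assumes I: "finite I"
  shows "emeasure (lborel_on I) (ecball I (\<lambda>_. 0) 1) = ennreal (unit_ball_volume I)"
    and "0 < unit_ball_volume I"
proof -
  interpret product_sigma_finite "\<lambda>_::'i. lborel :: real measure"
    by (rule product_sigma_finite_lborel)
  let ?B = "ecball I (\<lambda>_. 0) 1"
  have "?B \<subseteq> Pi\<^sub>E I (\<lambda>_. {-1..1})"
  proof
    fix x assume x: "x \<in> ?B"
    have "\<bar>x i\<bar> \<le> 1" if "i \<in> I" for i
    proof -
      have "(x i)\<^sup>2 \<le> (\<Sum>i\<in>I. (x i)\<^sup>2)" using I that by (intro member_le_sum) auto
      also have "\<dots> \<le> 1" using x edist_le_iff[of 1 I x "\<lambda>_. 0"] by (simp add: ecball_def)
      finally show ?thesis by (simp add: abs_square_le_1)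
    qed
    then show "x \<in> Pi\<^sub>E I (\<lambda>_. {-1..1})"
      using x by (auto simp: ecball_def space_PiM PiE_def abs_le_iff)
  qed
  then have "emeasure (lborel_on I) ?B \<le> emeasure (lborel_on I) (Pi\<^sub>E I (\<lambda>_. {-1..1}))"
    using I by (intro emeasure_mono) (auto intro!: sets_PiM_I_finite)
  also have "\<dots> < top" using I by (subst emeasure_PiM) (auto simp: power_less_top_ennreal)
  finally have fin: "emeasure (lborel_on I) ?B < top" .
  then show eq: "emeasure (lborel_on I) ?B = ennreal (unit_ball_volume I)"
    by (simp add: unit_ball_volume_def emeasure_eq_ennreal_measure)
  let ?e = "1 / real (card I + 1)"
  have sub: "Pi\<^sub>E I (\<lambda>_. {0..?e}) \<subseteq> ?B"
  proof
    fix x assume x: "x \<in> Pi\<^sub>E I (\<lambda>_. {0..?e})"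
    have "edist I x (\<lambda>_. 0) \<le> (\<Sum>i\<in>I. \<bar>x i\<bar>)"
      by (simp add: edist_def L2_set_le_sum_abs)
    also have "\<dots> \<le> (\<Sum>i\<in>I. ?e)" using x by (intro sum_mono) (fastforce simp: PiE_def Pi_def)
    also have "\<dots> \<le> 1" by simp
    finally show "x \<in> ?B" using x by (auto simp: ecball_def space_PiM PiE_def)
  qed
  have "0 < emeasure (lborel_on I) (Pi\<^sub>E I (\<lambda>_. {0..?e}))"
    using I by (subst emeasure_PiM) (auto simp: ennreal_power)
  also have "\<dots> \<le> emeasure (lborel_on I) ?B"
    using I sub by (intro emeasure_mono) auto
  finally show "0 < unit_ball_volume I" unfolding eq by simp
qed

lemma emeasure_ecball:
  assumes I: "finite I" and "0 < r"
  shows "emeasure (lborel_on I) (ecball I c r) = ennreal (r ^ card I * unit_ball_volume I)"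
proof -
  have "{x \<in> space (lborel_on I). (\<lambda>i\<in>I. c i + r * x i) \<in> ecball I c r} = ecball I (\<lambda>_. 0) 1"
  proof -
    have "edist I (\<lambda>i\<in>I. c i + r * x i) c = r * edist I x (\<lambda>_. 0)" for x
      using assms(2) unfolding edist_def L2_set_def
      by (simp add: power_mult_distrib real_sqrt_mult flip: sum_distrib_left cong: sum.cong)
    then show ?thesis using assms(2) by (auto simp: ecball_def space_PiM)
  qed
  then show ?thesis
    using emeasure_lborel_on_affine[OF I ecball_sets[OF I, of c r], of r c] assms
    by (simp add: unit_ball_volume ennreal_mult less_imp_le)
qed

text \<open>
  The midpoint of \<open>x\<close> and \<open>- y\<close> with \<open>x, y \<in> A\<close> has norm at most \<open>r\<close>.  So Prekopa--Leindler for
  the indicators of \<open>A\<close>, its reflection and the ball bounds the square of the volume of \<open>A\<close>.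
\<close>

lemma isodiametric:
  fixes I :: "'i set"
  assumes I: "finite I" and A: "A \<in> sets (lborel_on I)" and "0 < r"
    and diam: "\<And>x y. x \<in> A \<Longrightarrow> y \<in> A \<Longrightarrow> edist I x y \<le> 2 * r"
  shows "emeasure (lborel_on I) A \<le> ennreal (r ^ card I * unit_ball_volume I)"
proof -
  let ?N = "{x \<in> space (lborel_on I). (\<lambda>i\<in>I. 0 + - 1 * x i) \<in> A}"
  let ?B = "ecball I (\<lambda>_. 0) r"
  have N: "?N \<in> sets (lborel_on I)"
    using A by measurable
  have N_eq: "emeasure (lborel_on I) ?N = emeasure (lborel_on I) A"
    using emeasure_lborel_on_affine[OF I A, of "-1" "\<lambda>_. 0"] by simp
  have "(\<integral>\<^sup>+x. indicator A x \<partial>lborel_on I) * (\<integral>\<^sup>+x. indicator ?N x \<partial>lborel_on I)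
      \<le> (\<integral>\<^sup>+x. indicator ?B x \<partial>lborel_on I)\<^sup>2"
  proof (rule prekopa_leindler[OF I])
    fix x y :: "'i \<Rightarrow> real"
    have "(\<lambda>i\<in>I. (x i + y i) / 2) \<in> ?B" if "x \<in> A" "y \<in> ?N"
    proof -
      have "edist I x (\<lambda>i\<in>I. 0 + - 1 * y i) \<le> 2 * r" using diam that by auto
      moreover have "edist I x (\<lambda>i\<in>I. 0 + - 1 * y i) = 2 * edist I (\<lambda>i\<in>I. (x i + y i) / 2) (\<lambda>_. 0)"
        unfolding edist_def L2_set_def
        by (simp add: power_divide real_sqrt_divide flip: sum_divide_distrib cong: sum.cong)
      ultimately show ?thesis by (simp add: ecball_def space_PiM)
    qed
    then show "indicator A x * indicator ?N y \<le> (indicator ?B (\<lambda>i\<in>I. (x i + y i) / 2) :: ennreal)\<^sup>2"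
      by (auto simp: indicator_def)
  qed (use A N I in auto)
  then have le: "emeasure (lborel_on I) A * emeasure (lborel_on I) A \<le> (ennreal (r ^ card I * unit_ball_volume I))\<^sup>2"
    using A N I N_eq emeasure_ecball[OF I \<open>0 < r\<close>] by simp
  define w where "w = r ^ card I * unit_ball_volume I"
  have w: "w \<ge> 0" using unit_ball_volume(2)[OF I] \<open>0 < r\<close> by (simp add: w_def)
  show ?thesis
  proof (cases "emeasure (lborel_on I) A" rule: ennreal_cases)
    case (real a)
    then have "a * a \<le> w\<^sup>2" using le w by (simp add: ennreal_power flip: w_def ennreal_mult)
    then have "a \<le> w" using w by (metis power2_eq_square power2_le_imp_le)
    then show ?thesis using real w by (simp add: w_def)
  next
    case top
    have "(ennreal (r ^ card I * unit_ball_volume I))\<^sup>2 < top"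
      using w by (simp add: ennreal_power flip: w_def)
    then show ?thesis using le top by (simp add: ennreal_top_mult top_unique)
  qed
qed

section \<open>Partitions and lenses of the unit sphere\<close>

lemma edist_le_grid:
  assumes I: "finite I" and "0 < e" and "q = (sqrt (card I) + 1) / e"
    and eq: "\<And>i. i \<in> I \<Longrightarrow> \<lfloor>q * x i\<rfloor> = \<lfloor>q * y i\<rfloor>"
  shows "edist I x y \<le> e"
proof -
  have q: "q > 0" using assms(2,3) by (simp add: add_nonneg_pos)
  have "\<bar>x i - y i\<bar> \<le> 1 / q" if "i \<in> I" for i
  proof -
    have "\<bar>q * x i - q * y i\<bar> \<le> 1" using eq[OF that] by linarith
    then have "q * \<bar>x i - y i\<bar> \<le> 1" using q by (simp add: abs_mult flip: right_diff_distrib)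
    then show ?thesis using q by (simp add: field_simps)
  qed
  then have "edist I x y \<le> sqrt (card I) * (1 / q)" using I q by (intro edist_le_coord) auto
  also have "\<dots> = sqrt (card I) / (sqrt (card I) + 1) * e" unfolding assms(3) by simp
  also have "\<dots> \<le> 1 * e" using assms(2) by (intro mult_right_mono) (auto simp: divide_le_eq_1 add_nonneg_pos)
  finally show ?thesis by simp
qed

text \<open>
  The sets to be measured come from an arbitrary correspondence and need not be measurable.  The
  union of the cells of a fine grid that meet \<open>K\<close> is measurable and only slightly wider.
\<close>

lemma isodiametric_nonmeasurable:
  fixes I :: "'i set"
  assumes I: "finite I" and "0 \<le> r" "0 < e" and K: "K \<subseteq> space (lborel_on I)"
    and diam: "\<And>x y. x \<in> K \<Longrightarrow> y \<in> K \<Longrightarrow> edist I x y \<le> 2 * r"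
  obtains A where "A \<in> sets (lborel_on I)" "K \<subseteq> A"
    "emeasure (lborel_on I) A \<le> ennreal ((r + e) ^ card I * unit_ball_volume I)"
proof -
  define q where "q = (sqrt (card I) + 1) / e"
  define cell where "cell z = Pi\<^sub>E I (\<lambda>i. {t::real. \<lfloor>q * t\<rfloor> = z i})" for z :: "'i \<Rightarrow> int"
  define fl where "fl y = (\<lambda>i\<in>I. \<lfloor>q * y i\<rfloor>)" for y :: "'i \<Rightarrow> real"
  define A where "A = (\<Union>z\<in>fl ` K. cell z)"
  have "fl ` K \<subseteq> Pi\<^sub>E I (\<lambda>_. UNIV)" by (auto simp: fl_def)
  then have "countable (fl ` K)" using I by (meson countable_PiE countable_subset uncountable_def countableI_type)
  moreover have "cell z \<in> sets (lborel_on I)" for z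
    unfolding cell_def using I by (intro sets_PiM_I_finite) auto
  ultimately have "A \<in> sets (lborel_on I)" unfolding A_def by (intro sets.countable_UN') auto
  moreover have "K \<subseteq> A" using K by (auto simp: A_def cell_def fl_def space_PiM PiE_def)
  moreover have "emeasure (lborel_on I) A \<le> ennreal ((r + e) ^ card I * unit_ball_volume I)"
  proof (rule isodiametric[OF I])
    have near: "\<exists>y\<in>K. edist I x y \<le> e" if xA: "x \<in> A" for x
    proof -
      obtain y where y: "y \<in> K" "x \<in> cell (fl y)" using xA unfolding A_def by blast
      then have "\<lfloor>q * x i\<rfloor> = \<lfloor>q * y i\<rfloor>" if "i \<in> I" for i
        using that by (auto simp: cell_def fl_def PiE_def Pi_def)
      then show ?thesis using edist_le_grid[OF I \<open>0 < e\<close> q_def] y(1) by blast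
    qed
    fix x y assume "x \<in> A" "y \<in> A"
    then obtain x' y' where *: "x' \<in> K" "edist I x x' \<le> e" "y' \<in> K" "edist I y y' \<le> e"
      using near by meson
    have "edist I x y \<le> edist I x x' + (edist I x' y' + edist I y' y)"
      using edist_triangle[of I x y x'] edist_triangle[of I x' y y'] by linarith
    also have "\<dots> \<le> 2 * (r + e)"
      using * diam[OF *(1,3)] edist_commute[of I y y'] by simp
    finally show "edist I x y \<le> 2 * (r + e)" .
  qed (use assms \<open>A \<in> _\<close> in auto)
  ultimately show ?thesis using that by blast
qed

abbreviation enorm :: "'i set \<Rightarrow> ('i \<Rightarrow> real) \<Rightarrow> real" where
  "enorm I x \<equiv> edist I x (\<lambda>_. 0)"

lemma enorm_scale: "enorm I (\<lambda>i. c * x i) = \<bar>c\<bar> * enorm I x"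
  unfolding edist_def L2_set_def by (simp add: power_mult_distrib real_sqrt_mult flip: sum_distrib_left)

text \<open>
  Thickening each set radially into the shell \<open>1 - e < enorm I v \<le> 1\<close> turns a covering of the sphere
  into a covering of a full-dimensional region, to which the Euclidean isodiametric inequality
  applies.
\<close>

lemma sphere_partition_lower_bound:
  fixes I :: "'i set" and S :: "'j \<Rightarrow> ('i \<Rightarrow> real) set"
  assumes I: "finite I" and J: "finite J" and "0 \<le> r" "0 < e" "e < 1"
    and cover: "\<And>x. enorm I x = 1 \<Longrightarrow> (\<And>i. i \<notin> I \<Longrightarrow> x i = 0) \<Longrightarrow> \<exists>j\<in>J. x \<in> S j"
    and diam: "\<And>j x y. j \<in> J \<Longrightarrow> x \<in> S j \<Longrightarrow> y \<in> S j \<Longrightarrow> edist I x y \<le> 2 * r"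
  shows "1 - (1 - e) ^ card I \<le> real (card J) * (r + 2 * e) ^ card I"
proof -
  let ?M = "lborel_on I"
  define w where "w = unit_ball_volume I"
  have w: "w > 0" using unit_ball_volume(2)[OF I] by (simp add: w_def)
  \<comment> \<open>Radial projection to the sphere, set to zero outside \<open>I\<close> as the sphere points are.\<close>
  define nrm where "nrm v = (\<lambda>i. if i \<in> I then inverse (enorm I v) * v i else 0)" for v :: "'i \<Rightarrow> real"
  define Sh where "Sh = ecball I (\<lambda>_. 0) 1 - ecball I (\<lambda>_. 0) (1 - e)"
  define K where "K j = {v \<in> Sh. nrm v \<in> S j}" for j
  have Shd: "v \<in> space ?M" "1 - e < enorm I v" "enorm I v \<le> 1" if "v \<in> Sh" for v
    using that by (auto simp: Sh_def ecball_def)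
  have nrm1: "enorm I (nrm v) = 1" "edist I v (nrm v) \<le> e" if "v \<in> Sh" for v
  proof -
    have p: "0 < enorm I v" using Shd[OF that] \<open>e < 1\<close> by linarith
    have "enorm I (nrm v) = enorm I (\<lambda>i. inverse (enorm I v) * v i)"
      by (rule edist_cong) (auto simp: nrm_def)
    then show "enorm I (nrm v) = 1" unfolding enorm_scale using p by simp
    define N where "N = enorm I v"
    have "edist I v (nrm v) = edist I (\<lambda>i. (1 - inverse N) * v i) (\<lambda>_. 0)"
      unfolding edist_def by (rule L2_set_cong) (auto simp: nrm_def N_def[symmetric] algebra_simps)
    then have "edist I v (nrm v) = enorm I (\<lambda>i. (1 - inverse (enorm I v)) * v i)"
      by (simp add: N_def)
    also have "\<dots> = \<bar>enorm I v - 1\<bar>"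
      unfolding enorm_scale using p by (auto simp: abs_if field_simps)
    finally show "edist I v (nrm v) \<le> e" using Shd[OF that] by simp
  qed
  have "\<exists>A. A \<in> sets ?M \<and> K j \<subseteq> A \<and> emeasure ?M A \<le> ennreal ((r + 2 * e) ^ card I * w)" if "j \<in> J" for j
  proof -
    have diamK: "edist I x y \<le> 2 * (r + e)" if "x \<in> K j" "y \<in> K j" for x y
    proof -
      have "edist I x y \<le> edist I x (nrm x) + (edist I (nrm x) (nrm y) + edist I (nrm y) y)"
        using edist_triangle[of I x y "nrm x"] edist_triangle[of I "nrm x" y "nrm y"] by linarith
      also have "\<dots> \<le> e + (2 * r + e)"
        using that nrm1(2)[of x] nrm1(2)[of y] diam[OF \<open>j \<in> J\<close>, of "nrm x" "nrm y"]
        by (intro add_mono) (auto simp: K_def edist_commute)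
      finally show ?thesis by simp
    qed
    have "K j \<subseteq> space ?M" "0 \<le> r + e" using Shd(1) \<open>0 \<le> r\<close> \<open>0 < e\<close> by (auto simp: K_def)
    then obtain A where A: "A \<in> sets ?M" "K j \<subseteq> A"
      "emeasure ?M A \<le> ennreal ((r + e + e) ^ card I * unit_ball_volume I)"
      using isodiametric_nonmeasurable[OF I _ \<open>0 < e\<close> _ diamK] by blast
    moreover have "r + e + e = r + 2 * e" by simp
    ultimately show ?thesis unfolding w_def by metis
  qed
  then obtain A where A: "\<And>j. j \<in> J \<Longrightarrow> A j \<in> sets ?M" "\<And>j. j \<in> J \<Longrightarrow> K j \<subseteq> A j"
    "\<And>j. j \<in> J \<Longrightarrow> emeasure ?M (A j) \<le> ennreal ((r + 2 * e) ^ card I * w)" by metis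
  have Sh_sub: "Sh \<subseteq> (\<Union>j\<in>J. A j)"
  proof
    fix v assume v: "v \<in> Sh"
    obtain j where "j \<in> J" "nrm v \<in> S j"
      using cover[of "nrm v"] nrm1(1)[OF v] by (auto simp: nrm_def)
    then show "v \<in> (\<Union>j\<in>J. A j)" using v A(2) by (auto simp: K_def)
  qed
  have b1: "emeasure ?M (ecball I (\<lambda>_. 0) 1) = ennreal w"
    using unit_ball_volume(1)[OF I] by (simp add: w_def)
  have be: "emeasure ?M (ecball I (\<lambda>_. 0) (1 - e)) = ennreal ((1 - e) ^ card I * w)"
    using emeasure_ecball[OF I, of "1 - e"] \<open>e < 1\<close> by (simp add: w_def)
  have "ennreal w \<le> emeasure ?M (ecball I (\<lambda>_. 0) (1 - e) \<union> (\<Union>j\<in>J. A j))"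
    unfolding b1[symmetric] using Sh_sub I J A(1)
    by (intro emeasure_mono sets.Un sets.finite_UN) (auto simp: Sh_def)
  also have "\<dots> \<le> emeasure ?M (ecball I (\<lambda>_. 0) (1 - e)) + emeasure ?M (\<Union>j\<in>J. A j)"
    using I J A(1) by (intro emeasure_subadditive sets.finite_UN) auto
  also have "emeasure ?M (\<Union>j\<in>J. A j) \<le> (\<Sum>j\<in>J. emeasure ?M (A j))"
    using J A(1) by (intro emeasure_subadditive_finite) auto
  also have "\<dots> \<le> (\<Sum>j\<in>J. ennreal ((r + 2 * e) ^ card I * w))"
    using A(3) by (intro sum_mono)
  also have "\<dots> = ennreal (real (card J) * ((r + 2 * e) ^ card I * w))"
    using w \<open>0 \<le> r\<close> \<open>0 < e\<close> by (simp add: ennreal_mult ennreal_of_nat_eq_real_of_nat)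
  finally have "ennreal w \<le> ennreal ((1 - e) ^ card I * w + real (card J) * ((r + 2 * e) ^ card I * w))"
    using w \<open>0 \<le> r\<close> \<open>0 < e\<close> \<open>e < 1\<close> by (simp add: be ennreal_plus add_mono)
  then have "w \<le> (1 - e) ^ card I * w + real (card J) * ((r + 2 * e) ^ card I * w)"
    using w \<open>0 \<le> r\<close> \<open>0 < e\<close> \<open>e < 1\<close> by (subst (asm) ennreal_le_iff) auto
  then have "w * 1 \<le> w * ((1 - e) ^ card I + real (card J) * (r + 2 * e) ^ card I)"
    by (simp add: algebra_simps)
  then show ?thesis using w by (simp add: mult_le_cancel_left_pos)
qed

lemma sum_square_combination:
  fixes x y :: "'i \<Rightarrow> real"
  shows "(\<Sum>i\<in>I. (a * x i + b * y i)\<^sup>2)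
    = a\<^sup>2 * (\<Sum>i\<in>I. (x i)\<^sup>2) + 2 * a * b * (\<Sum>i\<in>I. x i * y i) + b\<^sup>2 * (\<Sum>i\<in>I. (y i)\<^sup>2)"
  unfolding sum_distrib_left sum.distrib[symmetric]
  by (rule sum.cong) (auto simp: power2_eq_square algebra_simps)

text \<open>
  Concentration of volume: a cap beyond height \<open>e\<close> lies in the ball of radius \<open>sqrt (1 - e\<^sup>2)\<close> about
  \<open>e * t\<close>, because \<open>(u - e t)\<^sup>2 = u\<^sup>2 - 2 e (u \<bullet> t) + e\<^sup>2 \<le> 1 - e\<^sup>2\<close> there.
\<close>

lemma ball_near_equator:
  fixes I :: "'i set"
  assumes I: "finite I" and t: "(\<Sum>i\<in>I. (t i)\<^sup>2) = 1" and e: "0 < e" "e < 1"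
  shows "ennreal ((1 - 2 * sqrt (1 - e\<^sup>2) ^ card I) * unit_ball_volume I)
    \<le> emeasure (lborel_on I) {u \<in> ecball I (\<lambda>_. 0) 1. \<bar>\<Sum>i\<in>I. u i * t i\<bar> \<le> e}"
proof -
  let ?M = "lborel_on I" and ?G = "{u \<in> ecball I (\<lambda>_. 0) 1. \<bar>\<Sum>i\<in>I. u i * t i\<bar> \<le> e}"
  let ?k = "sqrt (1 - e\<^sup>2)"
  have e2: "e\<^sup>2 < 1" using e by (simp add: abs_square_less_1)
  then have k: "?k > 0" by simp
  have G: "?G \<in> sets ?M"
    unfolding ecball_def using I by measurable
  have cap: "u \<in> ecball I (\<lambda>i. a * t i) ?k"
    if u: "u \<in> ecball I (\<lambda>_. 0) 1" and a: "a\<^sup>2 = e\<^sup>2" and ut: "e\<^sup>2 \<le> a * (\<Sum>i\<in>I. u i * t i)" for u a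
  proof -
    have u1: "(\<Sum>i\<in>I. (u i)\<^sup>2) \<le> 1" using u edist_le_iff[of 1 I u "\<lambda>_. 0"] by (simp add: ecball_def)
    have "(\<Sum>i\<in>I. (u i - a * t i)\<^sup>2) = (\<Sum>i\<in>I. (1 * u i + (- a) * t i)\<^sup>2)" by simp
    also have "\<dots> = (\<Sum>i\<in>I. (u i)\<^sup>2) - 2 * (a * (\<Sum>i\<in>I. u i * t i)) + e\<^sup>2"
      unfolding sum_square_combination t a[symmetric] by simp
    also have "\<dots> \<le> ?k\<^sup>2" using u1 ut e2 by simp
    finally show ?thesis using u k by (simp add: ecball_def edist_le_iff)
  qed
  have "ecball I (\<lambda>_. 0) 1 \<subseteq> ?G \<union> (ecball I (\<lambda>i. e * t i) ?k \<union> ecball I (\<lambda>i. - e * t i) ?k)"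
  proof
    fix u assume u: "u \<in> ecball I (\<lambda>_. 0) 1"
    let ?s = "\<Sum>i\<in>I. u i * t i"
    consider "\<bar>?s\<bar> \<le> e" | "e \<le> ?s" | "?s \<le> - e" by linarith
    then show "u \<in> ?G \<union> (ecball I (\<lambda>i. e * t i) ?k \<union> ecball I (\<lambda>i. - e * t i) ?k)"
    proof cases
      case 2 then show ?thesis using cap[OF u, of e] e by (simp add: power2_eq_square)
    next
      case 3 
      then have "e * e \<le> e * - ?s" using e by (intro mult_left_mono) auto
      then show ?thesis using cap[OF u, of "- e"] e by (simp add: power2_eq_square)
    qed (use u in auto)
  qed
  then have "emeasure ?M (ecball I (\<lambda>_. 0) 1)
      \<le> emeasure ?M (?G \<union> (ecball I (\<lambda>i. e * t i) ?k \<union> ecball I (\<lambda>i. - e * t i) ?k))"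
    using I G by (intro emeasure_mono) auto
  also have "\<dots> \<le> emeasure ?M ?G
      + (emeasure ?M (ecball I (\<lambda>i. e * t i) ?k) + emeasure ?M (ecball I (\<lambda>i. - e * t i) ?k))"
    using I G by (intro order.trans[OF emeasure_subadditive] add_left_mono emeasure_subadditive) auto
  finally have *: "ennreal (unit_ball_volume I) \<le> emeasure ?M ?G + ennreal (2 * (?k ^ card I * unit_ball_volume I))"
    using unit_ball_volume[OF I] k
    by (simp add: emeasure_ecball[OF I k] mult.commute flip: ennreal_plus)
  show ?thesis
  proof (cases "emeasure ?M ?G" rule: ennreal_cases)
    case (real g)
    then have "ennreal (unit_ball_volume I) \<le> ennreal (g + 2 * (?k ^ card I * unit_ball_volume I))"
      using * unit_ball_volume(2)[OF I] k by (simp flip: ennreal_plus)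
    then have "unit_ball_volume I \<le> g + 2 * (?k ^ card I * unit_ball_volume I)"
      using real unit_ball_volume(2)[OF I] k by (subst (asm) ennreal_le_iff) auto
    then show ?thesis unfolding real by (intro ennreal_leI) (simp add: algebra_simps)
  qed simp
qed

text \<open>
  The spheres of radius \<open>c\<close> about the origin and \<open>s\<close> about \<open>t\<close> meet orthogonally in a sphere with
  centre \<open>c\<^sup>2 t\<close> and radius \<open>c s\<close>.  Of the solid ball with this centre and radius, the part close to the
  equatorial hyperplane orthogonal to \<open>t\<close> lies in the lens, up to the factor \<open>sqrt (1 + e)\<close> in the radii.
\<close>

lemma lens_volume:
  fixes I :: "'i set"
  assumes I: "finite I" and t: "(\<Sum>i\<in>I. (t i)\<^sup>2) = 1" and e: "0 < e" "e < 1"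
    and cs: "0 < c" "0 < s" "c\<^sup>2 + s\<^sup>2 = 1"
  shows "ennreal ((c * s) ^ card I * ((1 - 2 * sqrt (1 - e\<^sup>2) ^ card I) * unit_ball_volume I))
    \<le> emeasure (lborel_on I) (ecball I (\<lambda>_. 0) (c * sqrt (1 + e)) \<inter> ecball I t (s * sqrt (1 + e)))"
proof -
  let ?M = "lborel_on I" and ?G = "{u \<in> ecball I (\<lambda>_. 0) 1. \<bar>\<Sum>i\<in>I. u i * t i\<bar> \<le> e}"
  let ?L = "ecball I (\<lambda>_. 0) (c * sqrt (1 + e)) \<inter> ecball I t (s * sqrt (1 + e))"
  let ?T = "\<lambda>x. \<lambda>i\<in>I. c\<^sup>2 * t i + (c * s) * x i"
  have cs2: "2 * c * s \<le> 1" using zero_le_power2[of "c - s"] cs(3) by (simp add: power2_eq_square algebra_simps)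
  have L: "?L \<in> sets ?M" using I by measurable
  have "?G \<subseteq> {x \<in> space ?M. ?T x \<in> ?L}"
  proof
    fix u assume u: "u \<in> ?G"
    have u1: "(\<Sum>i\<in>I. (u i)\<^sup>2) \<le> 1" using u edist_le_iff[of 1 I u "\<lambda>_. 0"] by (simp add: ecball_def)
    define P where "P = (\<Sum>i\<in>I. t i * u i)"
    have P: "\<bar>P\<bar> \<le> e" using u by (simp add: P_def mult.commute)
    have Pe: "2 * c * s * P \<le> e" "- (2 * c * s * P) \<le> e"
    proof -
      have "\<bar>2 * c * s * P\<bar> = (2 * c * s) * \<bar>P\<bar>" using cs by (simp add: abs_mult)
      also have "\<dots> \<le> 1 * e" using cs2 P e cs by (intro mult_mono) auto
      finally show "2 * c * s * P \<le> e" "- (2 * c * s * P) \<le> e" by auto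
    qed
    have "(\<Sum>i\<in>I. (?T u i - 0)\<^sup>2) = (\<Sum>i\<in>I. (c\<^sup>2 * t i + (c * s) * u i)\<^sup>2)" by simp
    also have "\<dots> = c\<^sup>2 * (c\<^sup>2 + 2 * c * s * P + s\<^sup>2 * (\<Sum>i\<in>I. (u i)\<^sup>2))"
      unfolding sum_square_combination t P_def by (simp add: power2_eq_square algebra_simps)
    also have "\<dots> \<le> c\<^sup>2 * (c\<^sup>2 + e + s\<^sup>2 * 1)"
      using u1 Pe by (intro mult_left_mono add_mono) auto
    also have "\<dots> = (c * sqrt (1 + e))\<^sup>2" using cs(3) e by (simp add: power_mult_distrib algebra_simps)
    finally have 1: "?T u \<in> ecball I (\<lambda>_. 0) (c * sqrt (1 + e))"
      using cs e by (simp add: ecball_def edist_le_iff space_PiM)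
    have c2: "c\<^sup>2 - 1 = - s\<^sup>2" using cs(3) by simp
    have "(\<Sum>i\<in>I. (?T u i - t i)\<^sup>2) = (\<Sum>i\<in>I. ((c\<^sup>2 - 1) * t i + (c * s) * u i)\<^sup>2)"
      by (intro sum.cong) (auto simp: algebra_simps)
    also have "\<dots> = s\<^sup>2 * (s\<^sup>2 + (- (2 * c * s * P)) + c\<^sup>2 * (\<Sum>i\<in>I. (u i)\<^sup>2))"
      unfolding sum_square_combination t P_def c2 by (simp add: power2_eq_square algebra_simps)
    also have "\<dots> \<le> s\<^sup>2 * (s\<^sup>2 + e + c\<^sup>2 * 1)"
      using u1 Pe by (intro mult_left_mono add_mono) auto
    also have "\<dots> = (s * sqrt (1 + e))\<^sup>2"
      using cs(3) e by (simp add: power_mult_distrib algebra_simps)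
    finally have 2: "?T u \<in> ecball I t (s * sqrt (1 + e))"
      using cs e by (simp add: ecball_def edist_le_iff space_PiM)
    show "u \<in> {x \<in> space ?M. ?T x \<in> ?L}" using 1 2 u by (auto simp: ecball_def)
  qed
  moreover have "{x \<in> space ?M. ?T x \<in> ?L} \<in> sets ?M"
    using L by measurable
  ultimately have "emeasure ?M ?G \<le> emeasure ?M {x \<in> space ?M. ?T x \<in> ?L}"
    by (intro emeasure_mono)
  then have "ennreal ((1 - 2 * sqrt (1 - e\<^sup>2) ^ card I) * unit_ball_volume I) \<le> emeasure ?M {x \<in> space ?M. ?T x \<in> ?L}"
    using ball_near_equator[OF I t e] by (rule order.trans[rotated])
  then have "ennreal ((c * s) ^ card I) * ennreal ((1 - 2 * sqrt (1 - e\<^sup>2) ^ card I) * unit_ball_volume I)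
      \<le> ennreal ((c * s) ^ card I) * emeasure ?M {x \<in> space ?M. ?T x \<in> ?L}"
    by (intro mult_left_mono) auto
  also have "\<dots> = emeasure ?M ?L"
    using emeasure_lborel_on_affine[OF I L, of "c * s" "\<lambda>i. c\<^sup>2 * t i"] cs by simp
  finally show ?thesis using cs by (simp add: ennreal_mult')
qed

section \<open>Economical coverings of the sphere\<close>

lemma averaging:
  fixes M :: "'a measure" and L :: "'t \<Rightarrow> 'a set" and p :: real
  assumes T: "finite T" "T \<noteq> {}" and Om: "Om \<in> fmeasurable M"
    and L: "\<And>t. t \<in> T \<Longrightarrow> L t \<in> sets M" "\<And>t. t \<in> T \<Longrightarrow> L t \<subseteq> Om"
    and big: "\<And>t. t \<in> T \<Longrightarrow> p * measure M Om < measure M (L t)"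
  shows "\<exists>w\<in>Om. p * card T \<le> card {t \<in> T. w \<in> L t}"
proof (rule ccontr)
  assume "\<not> ?thesis"
  then have small: "card {t \<in> T. w \<in> L t} < p * card T" if "w \<in> Om" for w
    using that by force
  have Lf: "L t \<in> fmeasurable M" if "t \<in> T" for t
    using fmeasurableI2[OF Om L(2)[OF that] L(1)[OF that]] .
  have "(\<Sum>t\<in>T. p * measure M Om) < (\<Sum>t\<in>T. measure M (L t))"
    using T big by (intro sum_strict_mono)
  also have "\<dots> = (\<integral>w. (\<Sum>t\<in>T. indicator (L t) w) \<partial>M)"
    using Lf by (subst Bochner_Integration.integral_sum)
      (auto simp: fmeasurable_def integrable_indicator_iff Int_absorb2 sets.sets_into_space less_top)
  also have "\<dots> \<le> (\<integral>w. p * card T * indicator Om w \<partial>M)"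
  proof (rule integral_mono)
    show "integrable M (\<lambda>w. \<Sum>t\<in>T. indicat_real (L t) w)"
      using Lf by (intro Bochner_Integration.integrable_sum) (auto simp: fmeasurable_def)
    show "integrable M (\<lambda>w. p * card T * indicat_real Om w)"
      using Om by (intro integrable_mult_right) (auto simp: fmeasurable_def)
    fix w
    have "(\<Sum>t\<in>T. indicat_real (L t) w) = card {t \<in> T. w \<in> L t}"
      using T(1) by (simp add: indicator_def sum.If_cases Int_def)
    moreover have "{t \<in> T. w \<in> L t} = {}" if "w \<notin> Om" using L(2) that by blast
    ultimately show "(\<Sum>t\<in>T. indicat_real (L t) w) \<le> p * card T * indicat_real Om w"
      using small[of w] by (cases "w \<in> Om") auto
  qed
  also have "\<dots> = p * card T * measure M Om"
    using Om by (simp add: fmeasurable_def Int_absorb2 sets.sets_into_space)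
  finally show False by simp
qed

text \<open>
  Each new centre captures at least the proportion \<open>p\<close> of the points not yet covered.
\<close>

lemma greedy_cover:
  fixes Q :: "'c \<Rightarrow> 't \<Rightarrow> bool" and p :: real
  assumes T: "finite T" and p: "0 < p" "p \<le> 1"
    and hit: "\<And>T'. T' \<subseteq> T \<Longrightarrow> T' \<noteq> {} \<Longrightarrow> \<exists>w\<in>Om. p * card T' \<le> card {t \<in> T'. Q w t}"
  shows "\<exists>C. finite C \<and> C \<subseteq> Om \<and> card C \<le> k \<and>
    real (card {t \<in> T. \<forall>w\<in>C. \<not> Q w t}) \<le> (1 - p) ^ k * card T"
proof (induction k)
  case 0 show ?case by (intro exI[of _ "{}"]) auto
next
  case (Suc k)
  then obtain C where C: "finite C" "C \<subseteq> Om" "card C \<le> k"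
    "real (card {t \<in> T. \<forall>w\<in>C. \<not> Q w t}) \<le> (1 - p) ^ k * card T" by blast
  define T' where "T' = {t \<in> T. \<forall>w\<in>C. \<not> Q w t}"
  show ?case
  proof (cases "T' = {}")
    case True
    then show ?thesis using C p by (intro exI[of _ C]) (auto simp flip: T'_def)
  next
    case False
    have fin: "finite T'" using T by (simp add: T'_def)
    have "T' \<subseteq> T" by (auto simp: T'_def)
    from hit[OF this False] obtain w where w: "w \<in> Om" "p * card T' \<le> card {t \<in> T'. Q w t}" by blast
    have eq: "{t \<in> T. \<forall>v\<in>insert w C. \<not> Q v t} = T' - {t \<in> T'. Q w t}" by (auto simp: T'_def)
    have "real (card {t \<in> T. \<forall>v\<in>insert w C. \<not> Q v t}) = real (card T') - real (card {t \<in> T'. Q w t})"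
      unfolding eq using fin by (subst card_Diff_subset) (auto intro!: of_nat_diff card_mono)
    also have "\<dots> \<le> (1 - p) * card T'" using w(2) by (simp add: algebra_simps)
    also have "\<dots> \<le> (1 - p) * ((1 - p) ^ k * card T)"
      using C(4) p unfolding T'_def by (intro mult_left_mono) auto
    finally show ?thesis using C w(1)
      by (intro exI[of _ "insert w C"]) (auto simp: card_insert_if)
  qed
qed

lemma greedy_cover_complete:
  fixes Q :: "'c \<Rightarrow> 't \<Rightarrow> bool" and p :: real
  assumes T: "finite T" and p: "0 < p" "p \<le> 1" and B: "real (card T) \<le> exp B" "0 \<le> B"
    and hit: "\<And>T'. T' \<subseteq> T \<Longrightarrow> T' \<noteq> {} \<Longrightarrow> \<exists>w\<in>Om. p * card T' \<le> card {t \<in> T'. Q w t}"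
  shows "\<exists>C. finite C \<and> C \<subseteq> Om \<and> card C \<le> B / p + 1 \<and> (\<forall>t\<in>T. \<exists>w\<in>C. Q w t)"
proof -
  \<comment> \<open>With \<open>k > B / p\<close> rounds, \<open>(1 - p) ^ k * card T \<le> exp (B - k * p) < 1\<close> points remain, hence none.\<close>
  define k where "k = nat \<lfloor>B / p\<rfloor> + 1"
  have k: "real k \<le> B / p + 1" "B / p < real k"
    using p B(2) unfolding k_def by (auto simp: floor_less_iff) linarith+
  obtain C where C: "finite C" "C \<subseteq> Om" "card C \<le> k"
    "real (card {t \<in> T. \<forall>w\<in>C. \<not> Q w t}) \<le> (1 - p) ^ k * card T"
    using greedy_cover[OF T p hit, of k] by blast
  have "1 - p \<le> exp (- p)" using exp_ge_add_one_self[of "- p"] by simp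
  then have "(1 - p) ^ k \<le> exp (- p) ^ k" using p by (intro power_mono) auto
  also have "\<dots> = exp (- (k * p))" by (simp add: exp_of_nat_mult[symmetric])
  finally have "(1 - p) ^ k * card T \<le> exp (- (k * p)) * exp B"
    using B by (intro mult_mono) auto
  also have "\<dots> < 1" using k(2) p by (simp add: field_simps flip: exp_add)
  finally have "card {t \<in> T. \<forall>w\<in>C. \<not> Q w t} = 0" using C(4) by linarith
  then have "{t \<in> T. \<forall>w\<in>C. \<not> Q w t} = {}" using T by simp
  then have "\<forall>t\<in>T. \<exists>w\<in>C. Q w t" by blast
  moreover have "real (card C) \<le> B / p + 1" using C(3) k(1) by linarith
  ultimately show ?thesis using C by blast
qed

text \<open>
  One representative for each grid cell that meets the sphere.  The cardinality
  \<open>exp (O (d\<^sup>2))\<close> is far from optimal, but only its logarithm enters the covering bound.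
\<close>

lemma sphere_net:
  fixes I :: "'i set"
  assumes I: "finite I" and e: "0 < e"
  obtains T where "finite T" "\<And>t. t \<in> T \<Longrightarrow> enorm I t = 1"
    "real (card T) \<le> exp (card I * (2 * ((card I + 1) / e) + 2))"
    "\<And>x. enorm I x = 1 \<Longrightarrow> \<exists>t\<in>T. edist I x t \<le> e"
proof -
  define q where "q = (sqrt (card I) + 1) / e"
  have q: "q > 0" using e by (simp add: q_def add_nonneg_pos)
  have qle: "q \<le> (card I + 1) / e"
  proof -
    have "sqrt (card I) \<le> card I" by (rule real_le_lsqrt) (auto simp: power2_eq_square simp flip: of_nat_mult)
    then show ?thesis using e unfolding q_def by (intro divide_right_mono) auto
  qed
  let ?U = "{x. enorm I x = 1}"
  define fl where "fl y = (\<lambda>i\<in>I. \<lfloor>q * y i\<rfloor>)" for y :: "'i \<Rightarrow> real"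
  define rep where "rep z = (SOME x. x \<in> ?U \<and> fl x = z)" for z
  have rep: "rep z \<in> ?U \<and> fl (rep z) = z" if "z \<in> fl ` ?U" for z
  proof -
    have "\<exists>x. x \<in> ?U \<and> fl x = z" using that by auto
    from someI_ex[OF this] show ?thesis unfolding rep_def .
  qed
  define F where "F = Pi\<^sub>E I (\<lambda>_. {\<lfloor>- q\<rfloor>..\<lfloor>q\<rfloor>})"
  have sub: "fl ` ?U \<subseteq> F"
  proof
    fix z assume "z \<in> fl ` ?U"
    then obtain x where x: "enorm I x = 1" "z = fl x" by auto
    have "\<bar>x i\<bar> \<le> 1" if "i \<in> I" for i
    proof -
      have "(x i)\<^sup>2 \<le> (\<Sum>i\<in>I. (x i)\<^sup>2)" using I that by (intro member_le_sum) auto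
      also have "\<dots> \<le> 1" using x edist_le_iff[of 1 I x "\<lambda>_. 0"] by simp
      finally show ?thesis by (simp add: abs_square_le_1)
    qed
    then have "- q \<le> q * x i" "q * x i \<le> q" if "i \<in> I" for i
      using that q mult_left_mono[of "x i" 1 q] mult_left_mono[of "-1" "x i" q] by (auto simp: abs_le_iff)
    then show "z \<in> F" unfolding x(2) fl_def F_def by (auto intro!: floor_mono)
  qed
  have finF: "finite F" unfolding F_def using I by (intro finite_PiE) auto
  define T where "T = rep ` (fl ` ?U)"
  have cF: "real (card F) \<le> exp (card I * (2 * ((card I + 1) / e) + 2))"
  proof -
    have "real (card F) = real (nat (\<lfloor>q\<rfloor> - \<lfloor>- q\<rfloor> + 1)) ^ card I"
      unfolding F_def using I by (subst card_PiE) (auto simp: algebra_simps)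
    also have "\<dots> \<le> (2 * q + 2) ^ card I"
      using q by (intro power_mono) linarith+
    also have "\<dots> \<le> exp (2 * q + 2) ^ card I"
      using q exp_ge_add_one_self[of "2 * q + 2"] by (intro power_mono) auto
    also have "\<dots> = exp (card I * (2 * q + 2))" by (simp add: exp_of_nat_mult)
    also have "\<dots> \<le> exp (card I * (2 * ((card I + 1) / e) + 2))"
      unfolding exp_le_cancel_iff by (intro mult_left_mono add_right_mono qle) auto
    finally show ?thesis .
  qed
  show ?thesis
  proof
    show "finite T" unfolding T_def using finite_subset[OF sub finF] by simp
    show "enorm I t = 1" if "t \<in> T" for t using that rep by (auto simp: T_def)
    have "card T \<le> card F" unfolding T_def
      using card_image_le[OF finite_subset[OF sub finF]] card_mono[OF finF sub] le_trans by blast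
    then show "real (card T) \<le> exp (card I * (2 * ((card I + 1) / e) + 2))" using cF by linarith
    fix x assume "enorm I x = 1"
    then have z: "fl x \<in> fl ` ?U" by simp
    have "edist I x (rep (fl x)) \<le> e"
    proof (rule edist_le_grid[OF I e q_def])
      fix i assume "i \<in> I"
      then show "\<lfloor>q * x i\<rfloor> = \<lfloor>q * rep (fl x) i\<rfloor>"
        using rep[OF z] by (metis fl_def restrict_apply')
    qed
    then show "\<exists>t\<in>T. edist I x t \<le> e" using z by (auto simp: T_def)
  qed
qed

text \<open>
  The lens volume says that a uniformly random centre in the ball of radius \<open>c * sqrt (1 + e)\<close> is
  close to a given net point with probability more than \<open>(s / sqrt (1 + e)) ^ d / 2\<close>; the greedy choice
  needs only the inverse of this probability times the logarithm of the size of the net.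
\<close>

lemma sphere_cover_upper_bound:
  fixes I :: "'i set"
  assumes I: "finite I" and e: "0 < e" "e < 1"
    and cs: "0 < c" "0 < s" "c\<^sup>2 + s\<^sup>2 = 1"
    and large: "sqrt (1 - e\<^sup>2) ^ card I < 1 / 4"
  shows "\<exists>C. finite C \<and>
    real (card C) \<le> 2 * card I * (2 * ((card I + 1) / e) + 2) * (sqrt (1 + e) / s) ^ card I + 1 \<and>
    (\<forall>x. enorm I x = 1 \<longrightarrow> (\<exists>w\<in>C. edist I x w \<le> s * sqrt (1 + e) + e))"
proof -
  let ?M = "lborel_on I"
  define u where "u = sqrt (1 + e)"
  have u: "u \<ge> 1" using e by (simp add: u_def)
  define V where "V = unit_ball_volume I"
  have V: "V > 0" using unit_ball_volume(2)[OF I] by (simp add: V_def)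
  obtain T where T: "finite T" "\<And>t. t \<in> T \<Longrightarrow> enorm I t = 1"
    "real (card T) \<le> exp (card I * (2 * ((card I + 1) / e) + 2))"
    "\<And>x. enorm I x = 1 \<Longrightarrow> \<exists>t\<in>T. edist I x t \<le> e"
    using sphere_net[OF I e(1)] by blast
  define Om where "Om = ecball I (\<lambda>_. 0) (c * u)"
  define L where "L t = Om \<inter> ecball I t (s * u)" for t
  have emOm: "emeasure ?M Om = ennreal ((c * u) ^ card I * V)"
    unfolding Om_def V_def using cs u by (intro emeasure_ecball[OF I]) auto
  then have Om: "Om \<in> fmeasurable ?M" using I unfolding Om_def by (intro fmeasurableI) auto
  have mOm: "measure ?M Om = (c * u) ^ card I * V"
    using emOm V cs u by (simp add: measure_def)
  \<comment> \<open>Half the ideal proportion, which leaves room for the loss near the equator.\<close>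
  define p where "p = (s / u) ^ card I / 2"
  have "s\<^sup>2 \<le> 1" using cs(3) zero_le_power2[of c] by linarith
  then have s1: "s \<le> 1" by (auto intro: power2_le_imp_le)
  have su: "0 < s / u" "s / u \<le> 1" using cs u s1 by (auto simp: divide_le_eq_1)
  have p: "0 < p" "p \<le> 1" using su power_le_one[of "s / u" "card I"] by (auto simp: p_def)
  have big: "p * measure ?M Om < measure ?M (L t)" if "t \<in> T" for t
  proof -
    have t: "(\<Sum>i\<in>I. (t i)\<^sup>2) = 1" using T(2)[OF that] edist_square[of I t "\<lambda>_. 0"] by simp
    have "p * measure ?M Om = (c * s) ^ card I * (V / 2)"
      unfolding p_def mOm using u by (simp add: power_mult_distrib power_divide)
    also have "\<dots> < (c * s) ^ card I * ((1 - 2 * sqrt (1 - e\<^sup>2) ^ card I) * V)"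
      using cs V large by (intro mult_strict_left_mono) auto
    finally have 1: "p * measure ?M Om < (c * s) ^ card I * ((1 - 2 * sqrt (1 - e\<^sup>2) ^ card I) * V)" .
    have Lf: "L t \<in> fmeasurable ?M"
      using I Om by (intro fmeasurableI2[OF Om]) (auto simp: L_def fmeasurable_def)
    have "ennreal ((c * s) ^ card I * ((1 - 2 * sqrt (1 - e\<^sup>2) ^ card I) * V)) \<le> ennreal (measure ?M (L t))"
      using lens_volume[OF I t e cs] emeasure_eq_measure2[OF Lf]
      by (simp add: L_def Om_def V_def u_def)
    then have "(c * s) ^ card I * ((1 - 2 * sqrt (1 - e\<^sup>2) ^ card I) * V) \<le> measure ?M (L t)"
      by (subst (asm) ennreal_le_iff) auto
    then show ?thesis using 1 by linarith
  qed
  let ?B = "card I * (2 * ((card I + 1) / e) + 2)"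
  have "\<exists>C. finite C \<and> C \<subseteq> Om \<and> card C \<le> ?B / p + 1 \<and> (\<forall>t\<in>T. \<exists>w\<in>C. w \<in> L t)"
  proof (rule greedy_cover_complete[OF T(1) p T(3)])
    show "0 \<le> ?B" using e by simp
    fix T' assume T': "T' \<subseteq> T" "T' \<noteq> {}"
    show "\<exists>w\<in>Om. p * card T' \<le> card {t \<in> T'. w \<in> L t}"
    proof (rule averaging[OF _ T'(2) Om])
      show "finite T'" using T' T(1) finite_subset by blast
    qed (use T' big I Om in \<open>auto simp: L_def fmeasurable_def\<close>)
  qed
  then obtain C where C: "finite C" "card C \<le> ?B / p + 1" "\<And>t. t \<in> T \<Longrightarrow> \<exists>w\<in>C. w \<in> L t" by blast
  have "\<exists>w\<in>C. edist I x w \<le> s * u + e" if x: "enorm I x = 1" for x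
  proof -
    obtain t where t: "t \<in> T" "edist I x t \<le> e" using T(4)[OF x] by blast
    obtain w where w: "w \<in> C" "edist I w t \<le> s * u" using C(3)[OF t(1)] by (auto simp: L_def ecball_def)
    then show ?thesis using edist_triangle[of I x w t] t(2) edist_commute[of I w t] by force
  qed
  moreover have "?B / p = 2 * card I * (2 * ((card I + 1) / e) + 2) * (u / s) ^ card I"
    unfolding p_def using cs u by (simp add: power_divide field_simps)
  ultimately show ?thesis using C by (intro exI[of _ C]) (simp add: u_def)
qed

section \<open>Gromov--Hausdorff distance of spheres\<close>

lemma in_sphere_iff: "x \<in> topspace (nsphere m) \<longleftrightarrow> (\<Sum>i\<le>m. (x i)\<^sup>2) = 1 \<and> (\<forall>i>m. x i = 0)"
  by (auto simp: nsphere)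

lemma sphere_enorm: "x \<in> topspace (nsphere m) \<longleftrightarrow> enorm {..m} x = 1 \<and> (\<forall>i. i \<notin> {..m} \<longrightarrow> x i = 0)"
  by (auto simp: in_sphere_iff edist_def L2_set_def)

lemma edist_square_sphere:
  assumes "x \<in> topspace (nsphere m)" "y \<in> topspace (nsphere m)"
  shows "(edist {..m} x y)\<^sup>2 = 2 - 2 * (\<Sum>i\<le>m. x i * y i)"
proof -
  have "(edist {..m} x y)\<^sup>2 = (\<Sum>i\<le>m. (1 * x i + (- 1) * y i)\<^sup>2)" unfolding edist_square by simp
  also have "\<dots> = 2 - 2 * (\<Sum>i\<le>m. x i * y i)"
    unfolding sum_square_combination using assms by (simp add: in_sphere_iff)
  finally show ?thesis .
qed

lemma inner_sphere_bounds:
  assumes "x \<in> topspace (nsphere m)" "y \<in> topspace (nsphere m)"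
  shows "- 1 \<le> (\<Sum>i\<le>m. x i * y i)" "(\<Sum>i\<le>m. x i * y i) \<le> 1"
proof -
  have "0 \<le> (edist {..m} x y)\<^sup>2" by simp
  then show "(\<Sum>i\<le>m. x i * y i) \<le> 1" unfolding edist_square_sphere[OF assms] by simp
  have "0 \<le> (\<Sum>i\<le>m. (1 * x i + 1 * y i)\<^sup>2)" by (intro sum_nonneg) auto
  then show "- 1 \<le> (\<Sum>i\<le>m. x i * y i)"
    unfolding sum_square_combination using assms by (simp add: in_sphere_iff)
qed

lemma sphere_dist_bounds:
  assumes "x \<in> topspace (nsphere m)" "y \<in> topspace (nsphere m)"
  shows "0 \<le> sphere_dist m x y" "sphere_dist m x y \<le> pi"
  unfolding sphere_dist_def using inner_sphere_bounds[OF assms] by (auto intro: arccos_lbound arccos_ubound)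

text \<open>
  The chord of an arc of angle \<open>2 a\<close> has length \<open>2 sin a\<close>.
\<close>

lemma sphere_dist_le_iff_edist_le:
  assumes "x \<in> topspace (nsphere m)" "y \<in> topspace (nsphere m)" and a: "0 \<le> a" "a \<le> pi / 2"
  shows "sphere_dist m x y \<le> 2 * a \<longleftrightarrow> edist {..m} x y \<le> 2 * sin a"
proof -
  let ?p = "\<Sum>i\<le>m. x i * y i"
  note p = inner_sphere_bounds[OF assms(1,2)]
  have "sphere_dist m x y \<le> 2 * a \<longleftrightarrow> arccos ?p \<le> arccos (cos (2 * a))"
    unfolding sphere_dist_def using a by (simp add: arccos_cos)
  also have "\<dots> \<longleftrightarrow> cos (2 * a) \<le> ?p" using p by (intro arccos_le_mono) auto
  also have "\<dots> \<longleftrightarrow> (edist {..m} x y)\<^sup>2 \<le> (2 * sin a)\<^sup>2"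
    unfolding edist_square_sphere[OF assms(1,2)] cos_double_sin by (auto simp: power_mult_distrib)
  also have "\<dots> \<longleftrightarrow> edist {..m} x y \<le> 2 * sin a"
    using a sin_ge_zero[of a] edist_nonneg by (subst power_mono_iff) auto
  finally show ?thesis .
qed

lemma distortion_upper:
  assumes R: "correspondence (topspace (nsphere m)) (topspace (nsphere n)) R"
    and "(x, y) \<in> R" "(x', y') \<in> R"
  shows "\<bar>sphere_dist m x x' - sphere_dist n y y'\<bar> \<le> distortion (sphere_dist m) (sphere_dist n) R"
proof -
  let ?f = "\<lambda>((x, y), (x', y')). \<bar>sphere_dist m x x' - sphere_dist n y y'\<bar>"
  have "?f z \<le> pi" if "z \<in> R \<times> R" for z
  proof -
    obtain x y x' y' where z: "z = ((x, y), (x', y'))" by (metis surj_pair)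
    then have "x \<in> topspace (nsphere m)" "x' \<in> topspace (nsphere m)"
      "y \<in> topspace (nsphere n)" "y' \<in> topspace (nsphere n)"
      using R that by (auto simp: correspondence_def)
    then show ?thesis unfolding z
      using sphere_dist_bounds[of x m x'] sphere_dist_bounds[of y n y'] by auto
  qed
  then have "bdd_above (?f ` (R \<times> R))" by (intro bdd_aboveI2)
  then have "?f ((x, y), (x', y')) \<le> (SUP z\<in>R \<times> R. ?f z)"
    using assms(2,3) by (intro cSUP_upper) auto
  then show ?thesis by (simp add: distortion_def)
qed

lemma correspondence_of_GH_dist_less:
  assumes "sphere_GH_dist m n < v"
  obtains R where "correspondence (topspace (nsphere m)) (topspace (nsphere n)) R"
    "distortion (sphere_dist m) (sphere_dist n) R < 2 * v"
proof -
  let ?C = "{R. correspondence (topspace (nsphere m)) (topspace (nsphere n)) R}"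
  have "topspace (nsphere m) \<times> topspace (nsphere n) \<in> ?C"
    using in_topspace_nsphere[of m] in_topspace_nsphere[of n] by (auto simp: correspondence_def)
  then have ne: "?C \<noteq> {}" by blast
  have "(INF R\<in>?C. distortion (sphere_dist m) (sphere_dist n) R) < 2 * v"
    using assms by (simp add: sphere_GH_dist_def GH_dist_def)
  then obtain R where "R \<in> ?C" "distortion (sphere_dist m) (sphere_dist n) R < 2 * v"
    using cInf_lessD[of "distortion (sphere_dist m) (sphere_dist n) ` ?C"] ne by blast
  then show ?thesis using that by blast
qed

lemma sphere_GH_dist_nonneg: "0 \<le> sphere_GH_dist m n"
proof (rule ccontr)
  assume "\<not> ?thesis"
  then obtain R where R: "correspondence (topspace (nsphere m)) (topspace (nsphere n)) R"
    "distortion (sphere_dist m) (sphere_dist n) R < 2 * 0"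
    using correspondence_of_GH_dist_less[of m n 0] by auto
  have "R \<noteq> {}" using R(1) in_topspace_nsphere[of m] by (auto simp: correspondence_def)
  then obtain x y where "(x, y) \<in> R" by auto
  from distortion_upper[OF R(1) this this] R(2) show False by simp
qed

text \<open>
  The sets covering the large sphere are the images, under a correspondence, of the traces on the
  small sphere of Euclidean balls of radius \<open>sin y\<close>.
\<close>

lemma GH_dist_less_imp_cover_bound:
  assumes GH: "sphere_GH_dist m n < x - y" and xy: "0 \<le> y" "y \<le> x" "x \<le> pi / 2"
    and C: "finite C" "\<And>p. enorm {..m} p = 1 \<Longrightarrow> \<exists>w\<in>C. edist {..m} p w \<le> sin y"
    and e: "0 < e" "e < 1"
  shows "1 - (1 - e) ^ Suc n \<le> real (card C) * (sin x + 2 * e) ^ Suc n"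
proof -
  obtain R where R: "correspondence (topspace (nsphere m)) (topspace (nsphere n)) R"
    "distortion (sphere_dist m) (sphere_dist n) R < 2 * (x - y)"
    using correspondence_of_GH_dist_less[OF GH] by blast
  define S where "S w = {q \<in> topspace (nsphere n). \<exists>p. (p, q) \<in> R \<and> edist {..m} p w \<le> sin y}" for w
  have "1 - (1 - e) ^ card {..n} \<le> real (card C) * (sin x + 2 * e) ^ card {..n}"
  proof (rule sphere_partition_lower_bound[OF _ C(1) _ e])
    show "0 \<le> sin x" using xy by (intro sin_ge_zero) auto
    fix q :: "nat \<Rightarrow> real" assume "enorm {..n} q = 1" "\<And>i. i \<notin> {..n} \<Longrightarrow> q i = 0"
    then have q: "q \<in> topspace (nsphere n)" by (auto simp: sphere_enorm)
    then have "q \<in> snd ` R" using R(1) by (simp add: correspondence_def)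
    then obtain p where p: "(p, q) \<in> R" by auto
    then have "p \<in> topspace (nsphere m)" using R(1) by (auto simp: correspondence_def)
    then show "\<exists>w\<in>C. q \<in> S w" using C(2)[of p] p q by (auto simp: S_def sphere_enorm)
  next
    fix w q q' assume "w \<in> C" "q \<in> S w" "q' \<in> S w"
    then obtain p p' where p: "(p, q) \<in> R" "(p', q') \<in> R"
      "edist {..m} p w \<le> sin y" "edist {..m} p' w \<le> sin y"
      and q: "q \<in> topspace (nsphere n)" "q' \<in> topspace (nsphere n)" by (auto simp: S_def)
    have ps: "p \<in> topspace (nsphere m)" "p' \<in> topspace (nsphere m)"
      using R(1) p by (auto simp: correspondence_def)
    have "edist {..m} p p' \<le> 2 * sin y"
      using edist_triangle[of "{..m}" p p' w] p(3,4) edist_commute[of "{..m}" w p'] by linarith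
    then have "sphere_dist m p p' \<le> 2 * y"
      using sphere_dist_le_iff_edist_le[OF ps] xy by simp
    then have "sphere_dist n q q' \<le> 2 * x"
      using distortion_upper[OF R(1) p(1,2)] R(2) unfolding abs_le_iff by (auto simp: algebra_simps)
    then show "edist {..n} q q' \<le> 2 * sin x"
      using sphere_dist_le_iff_edist_le[OF q] xy by simp
  qed simp
  then show ?thesis by simp
qed

lemma sin_in_unit_interval:
  assumes "0 < x" "x < pi / 2"
  shows "0 < sin x" "sin x < 1"
  using assms sin_gt_zero[of x] sin_monotone_2pi[of x "pi / 2"] by auto

text \<open>
  If the distance were below \<open>x - y\<close>, the two counting bounds would give
  \<open>1 / 2 \<le> P (m + 1) * a ^ n / b ^ m\<close> with a polynomial \<open>P\<close>, where \<open>a\<close> is slightly above \<open>sin x\<close> and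
  \<open>b\<close> slightly below \<open>sin y\<close>.  As \<open>n\<close> grows like \<open>l * m\<close> and \<open>a powr l < b\<close>, the right-hand side decays
  exponentially.
\<close>

lemma sphere_GH_dist_eventually_ge:
  fixes m n :: "nat \<Rightarrow> nat" and l :: real
  assumes m: "filterlim m at_top sequentially" and l: "l > 1"
    and nm: "(\<lambda>j. real (n j) / real (m j)) \<longlonglongrightarrow> l"
    and x: "0 < x" "x < pi / 2" and y: "0 < y" "y < pi / 2" and key: "sin x powr l < sin y"
  shows "\<forall>\<^sub>F j in sequentially. x - y \<le> sphere_GH_dist (m j) (n j)"
proof (cases "y \<le> x")
  case False
  then have "x - y \<le> sphere_GH_dist (m j) (n j)" for j
    using sphere_GH_dist_nonneg[of "m j" "n j"] by linarith
  then show ?thesis by simp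
next
  case True
  \<comment> \<open>Slack is introduced in stages: \<open>sin x powr l < b < s < sin y\<close>, then \<open>e\<close> for the covering radius,
    and \<open>t\<close> both for \<open>a > sin x\<close> and for an exponent below \<open>l\<close>.\<close>
  define b where "b = (sin x powr l + sin y) / 2"
  have sx: "0 < sin x" "sin x < 1" using sin_in_unit_interval[OF x] by auto
  have sy: "0 < sin y" "sin y < 1" using sin_in_unit_interval[OF y] by auto
  have b: "sin x powr l < b" "b < sin y" "0 < b" "b < 1" using key sy add_nonneg_pos[OF powr_ge_zero sy(1), of "sin x" l] by (auto simp: b_def)
  define s where "s = (b + sin y) / 2"
  have s: "0 < s" "s < 1" "b < s" "s < sin y" using b sy by (auto simp: s_def)
  have "\<forall>\<^sub>F e in at_right 0. s * sqrt (1 + e) + e < sin y"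
  proof (rule order_tendstoD(2))
    show "((\<lambda>e. s * sqrt (1 + e) + e) \<longlongrightarrow> s * sqrt (1 + 0) + 0) (at_right 0)"
      by (intro tendsto_intros)
  qed (use s in simp)
  moreover have "\<forall>\<^sub>F e in at_right 0. b < s / sqrt (1 + e)"
  proof (rule order_tendstoD(1))
    show "((\<lambda>e. s / sqrt (1 + e)) \<longlongrightarrow> s / sqrt (1 + 0)) (at_right 0)"
      by (intro tendsto_intros) auto
  qed (use s in simp)
  moreover have "\<forall>\<^sub>F e::real in at_right 0. 0 < e \<and> e < 1"
    by (rule eventually_at_right_field[THEN iffD2]) (intro exI[of _ 1], auto)
  ultimately have "\<forall>\<^sub>F e in at_right 0. s * sqrt (1 + e) + e < sin y \<and> b < s / sqrt (1 + e) \<and> 0 < e \<and> e < 1"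
    by eventually_elim auto
  then obtain e where e: "s * sqrt (1 + e) + e < sin y" "b < s / sqrt (1 + e)" "0 < e" "e < 1"
    using eventually_happens[of _ "at_right (0::real)"] by (auto simp: trivial_limit_at_right_real)
  have "\<forall>\<^sub>F t in at_right 0. (sin x + t) powr (l - t) < b"
  proof (rule order_tendstoD(2))
    show "((\<lambda>t. (sin x + t) powr (l - t)) \<longlongrightarrow> (sin x + 0) powr (l - 0)) (at_right 0)"
      using sx by (intro tendsto_intros) auto
  qed (use b in simp)
  moreover have "\<forall>\<^sub>F t in at_right 0. 0 < t \<and> t < min (1 - sin x) l"
    using sx l by (intro eventually_at_right_field[THEN iffD2] exI[of _ "min (1 - sin x) l"]) auto
  ultimately have "\<forall>\<^sub>F t in at_right 0. (sin x + t) powr (l - t) < b \<and> 0 < t \<and> t < min (1 - sin x) l"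
    by eventually_elim auto
  then obtain t where t: "(sin x + t) powr (l - t) < b" "0 < t" "t < 1 - sin x" "t < l"
    using eventually_happens[of _ "at_right (0::real)"] by (auto simp: trivial_limit_at_right_real)
  define a where "a = sin x + t"
  define \<theta> where "\<theta> = a powr (l - t) / b"
  have a: "0 < a" "a < 1" using t sx by (auto simp: a_def)
  have th: "0 < \<theta>" "\<theta> < 1" using t(1) b a by (auto simp: \<theta>_def a_def)
  define c where "c = sqrt (1 - s\<^sup>2)"
  have s2: "s\<^sup>2 < 1" using s by (simp add: abs_square_less_1)
  have c: "0 < c" "c\<^sup>2 + s\<^sup>2 = 1" using s2 by (auto simp: c_def)
  define P where "P d = 2 * d * (2 * ((d + 1) / e) + 2) + 1" for d :: real
  have mreal: "filterlim (\<lambda>j. real (m j)) at_top sequentially"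
    using m by (rule filterlim_compose[OF filterlim_real_sequentially])
  have E1: "\<forall>\<^sub>F j in sequentially. sqrt (1 - e\<^sup>2) ^ (m j + 1) < 1 / 4"
  proof -
    have "0 \<le> sqrt (1 - e\<^sup>2)" "sqrt (1 - e\<^sup>2) < 1" using e by (auto simp: abs_square_less_1 power_le_one)
    then have "(\<lambda>k. sqrt (1 - e\<^sup>2) ^ (k + 1)) \<longlonglongrightarrow> 0"
      by (intro LIMSEQ_ignore_initial_segment LIMSEQ_realpow_zero)
    from order_tendstoD(2)[OF filterlim_compose[OF this m], of "1 / 4"] show ?thesis by simp
  qed
  have E2: "\<forall>\<^sub>F j in sequentially. (l - t) * m j \<le> n j"
  proof -
    have "\<forall>\<^sub>F j in sequentially. l - t < real (n j) / real (m j)"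
      using nm t(2) by (intro order_tendstoD(1)) auto
    moreover have "\<forall>\<^sub>F j in sequentially. 1 \<le> m j"
      using m unfolding filterlim_at_top by blast
    ultimately show ?thesis by eventually_elim (simp add: field_simps)
  qed
  have nlim: "filterlim n at_top sequentially"
  proof -
    have "filterlim (\<lambda>j. (l - t) * real (m j)) at_top sequentially"
      using t(4) by (intro filterlim_tendsto_pos_mult_at_top[OF tendsto_const _ mreal]) auto
    then have "filterlim (\<lambda>j. real (n j)) at_top sequentially"
      by (rule filterlim_at_top_mono) (rule E2)
    then show ?thesis by (simp add: filterlim_sequentially_iff_filterlim_real)
  qed
  have E3: "\<forall>\<^sub>F j in sequentially. (1 - t / 2) ^ Suc (n j) < 1 / 2"
  proof -
    have "(\<lambda>k. (1 - t / 2) ^ (Suc k)) \<longlonglongrightarrow> 0"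
      using t sx by (intro LIMSEQ_Suc LIMSEQ_realpow_zero) auto
    from order_tendstoD(2)[OF filterlim_compose[OF this nlim], of "1 / 2"] show ?thesis by simp
  qed
  have E4: "\<forall>\<^sub>F j in sequentially. P (real (m j + 1)) * (\<theta> ^ m j / b) < 1 / 2"
  proof -
    have "(\<lambda>k::nat. P (real (k + 1)) * (\<theta> ^ k / b)) \<longlonglongrightarrow> 0"
      unfolding P_def using th b(3) e(3) by real_asymp
    from order_tendstoD(2)[OF filterlim_compose[OF this m], of "1 / 2"] show ?thesis by simp
  qed
  show ?thesis using E1 E2 E3 E4
  proof eventually_elim
    case (elim j)
    let ?d = "real (m j + 1)"
    show ?case
    proof (rule ccontr)
      assume "\<not> ?case"
      then have GH: "sphere_GH_dist (m j) (n j) < x - y" by simp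
      obtain C where C: "finite C"
        "real (card C) \<le> 2 * card {..m j} * (2 * ((card {..m j} + 1) / e) + 2) * (sqrt (1 + e) / s) ^ card {..m j} + 1"
        "\<And>p. enorm {..m j} p = 1 \<Longrightarrow> (\<exists>w\<in>C. edist {..m j} p w \<le> s * sqrt (1 + e) + e)"
        using sphere_cover_upper_bound[of "{..m j}" e c s] e(3,4) c s(1) elim(1) by auto
      have cov: "\<exists>w\<in>C. edist {..m j} p w \<le> sin y" if "enorm {..m j} p = 1" for p
        using C(3)[OF that] e(1) by force
      have cb: "real (card C) \<le> P ?d * (1 / b) ^ (m j + 1)"
      proof -
        have "sqrt (1 + e) / s \<le> 1 / b" using e(2,3) s b by (simp add: field_simps)
        then have "(sqrt (1 + e) / s) ^ (m j + 1) \<le> (1 / b) ^ (m j + 1)"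
          using s e by (intro power_mono) auto
        then have "2 * ?d * (2 * ((?d + 1) / e) + 2) * (sqrt (1 + e) / s) ^ (m j + 1) + 1
            \<le> 2 * ?d * (2 * ((?d + 1) / e) + 2) * (1 / b) ^ (m j + 1) + (1 / b) ^ (m j + 1)"
          using b e by (intro add_mono mult_left_mono one_le_power) auto
        also have "\<dots> = P ?d * (1 / b) ^ (m j + 1)" by (simp add: P_def algebra_simps)
        finally show ?thesis using C(2) by simp
      qed
      have "1 / 2 \<le> 1 - (1 - t / 2) ^ Suc (n j)" using elim(3) by simp
      also have "\<dots> \<le> real (card C) * (sin x + 2 * (t / 2)) ^ Suc (n j)"
        using t sx x y True by (intro GH_dist_less_imp_cover_bound[OF GH _ _ _ C(1) cov]) auto
      also have "\<dots> = real (card C) * a ^ Suc (n j)" by (simp add: a_def)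
      also have "\<dots> \<le> (P ?d * (1 / b) ^ (m j + 1)) * a powr ((l - t) * m j)"
      proof (intro mult_mono cb)
        have "a ^ Suc (n j) = a powr (real (Suc (n j)))" using a by (simp only: powr_realpow)
        also have "\<dots> \<le> a powr ((l - t) * m j)" using a elim(2) by (intro powr_mono') auto
        finally show "a ^ Suc (n j) \<le> a powr ((l - t) * m j)" .
        show "0 \<le> P ?d * (1 / b) ^ (m j + 1)" using b e by (simp add: P_def)
      qed (use a in auto)
      also have "a powr ((l - t) * m j) = (a powr (l - t)) ^ m j"
        using a by (simp add: powr_powr[symmetric] powr_realpow)
      also have "(P ?d * (1 / b) ^ (m j + 1)) * (a powr (l - t)) ^ m j = P ?d * (\<theta> ^ m j / b)"
        by (simp add: \<theta>_def power_divide)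
      finally show False using elim(4) by simp
    qed
  qed
qed

section \<open>Vietoris--Rips complexes containing a cross-polytope\<close>

lemma inner_of_bool_sets:
  fixes S T :: "nat set"
  assumes "S \<subseteq> {..m}"
  shows "(\<Sum>i\<le>m. (of_bool (i \<in> S) / c) * (of_bool (i \<in> T) / c)) = card (S \<inter> T) / (c * c :: real)"
proof -
  have "(\<Sum>i\<le>m. (of_bool (i \<in> S) / c) * (of_bool (i \<in> T) / c)) = (\<Sum>i\<le>m. of_bool (i \<in> S \<inter> T)) / (c * c)"
    unfolding sum_divide_distrib by (rule sum.cong) auto
  also have "(\<Sum>i\<le>m. of_bool (i \<in> S \<inter> T)) = real (card (S \<inter> T))"
  proof -
    have "{..m} \<inter> {i. i \<in> S \<inter> T} = S \<inter> T" using assms by auto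
    then show ?thesis by (simp add: of_bool_def sum.If_cases)
  qed
  finally show ?thesis .
qed

text \<open>
  The vectors are normalized indicators of graphs of affine functions \<open>a \<mapsto> b * a + c\<close> on
  \<open>{..<q}\<close> with slope \<open>b < B\<close> and intercept \<open>c < B * q\<close>.  Two distinct such graphs meet in at most one
  point, and there are quadratically many in \<open>B\<close> while the dimension is linear in \<open>B\<close>.
\<close>

lemma nearly_orthogonal_vectors:
  assumes q: "0 < q" and B: "0 < B" and dim: "2 * B * q * q \<le> Suc m"
  obtains v :: "nat \<Rightarrow> nat \<Rightarrow> real" where
    "\<And>k. k < B * B * q \<Longrightarrow> v k \<in> topspace (nsphere m)"
    "\<And>k k'. k < B * B * q \<Longrightarrow> k' < B * B * q \<Longrightarrow> k \<noteq> k' \<Longrightarrow> 0 \<le> (\<Sum>i\<le>m. v k i * v k' i)"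
    "\<And>k k'. k < B * B * q \<Longrightarrow> k' < B * B * q \<Longrightarrow> k \<noteq> k' \<Longrightarrow> (\<Sum>i\<le>m. v k i * v k' i) \<le> 1 / q"
proof -
  \<comment> \<open>The argument \<open>k\<close> encodes slope and intercept by division with remainder; the point
    \<open>(a, b * a + c)\<close> of the graph is coordinate number \<open>a * W + (b * a + c)\<close>.\<close>
  define W where "W = 2 * B * q"
  define line where "line k a = (k div (B * q)) * a + k mod (B * q)" for k a
  define S where "S k = (\<lambda>a. a * W + line k a) ` {..<q}" for k
  define v where "v k i = of_bool (i \<in> S k) / sqrt q" for k i
  have Bq: "0 < B * q" using q B by simp
  have lineW: "line k a < W" if "k < B * B * q" "a < q" for k a
  proof -
    have "k div (B * q) < B" using that(1) Bq by (simp add: less_mult_imp_div_less ac_simps)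
    then have "k div (B * q) * a \<le> B * q" using that(2) by (intro mult_le_mono) auto
    moreover have "k mod (B * q) < B * q" using Bq by simp
    ultimately show ?thesis by (simp add: line_def W_def)
  qed
  have dv: "(a * W + line k a) div W = a" "(a * W + line k a) mod W = line k a" if "k < B * B * q" "a < q" for k a
    using lineW[OF that] by auto
  have Ssub: "S k \<subseteq> {..m}" if k: "k < B * B * q" for k
  proof
    fix i assume "i \<in> S k"
    then obtain a where a: "a < q" "i = a * W + line k a" by (auto simp: S_def)
    have "i < a * W + W" using a lineW[OF k a(1)] by simp
    also have "\<dots> = Suc a * W" by simp
    also have "\<dots> \<le> q * W" using a(1) by (intro mult_le_mono) auto
    also have "\<dots> \<le> Suc m" using dim by (simp add: W_def ac_simps)
    finally show "i \<in> {..m}" by simp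
  qed
  have cardS: "card (S k) = q" if k: "k < B * B * q" for k
  proof -
    have "inj_on (\<lambda>a. a * W + line k a) {..<q}"
      by (rule inj_on_inverseI[where g = "\<lambda>i. i div W"]) (use dv(1)[OF k] in auto)
    then show ?thesis unfolding S_def by (simp add: card_image)
  qed
  have inner: "(\<Sum>i\<le>m. v k i * v k' i) = card (S k \<inter> S k') / q" if "k < B * B * q" for k k'
    unfolding v_def using inner_of_bool_sets[OF Ssub[OF that], of "sqrt q" "S k'"] by simp
  have meet: "card (S k \<inter> S k') \<le> 1" if k: "k < B * B * q" "k' < B * B * q" "k \<noteq> k'" for k k'
  proof -
    have "i = j" if ij: "i \<in> S k \<inter> S k'" "j \<in> S k \<inter> S k'" for i j
    proof -
      have common: "\<exists>a<q. i = a * W + line k a \<and> line k a = line k' a" if i: "i \<in> S k \<inter> S k'" for i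
      proof -
        obtain a where a: "a < q" "i = a * W + line k a" using i by (auto simp: S_def)
        obtain a' where a': "a' < q" "i = a' * W + line k' a'" using i by (auto simp: S_def)
        have "i div W = a" "i mod W = line k a" unfolding a(2) by (rule dv[OF k(1) a(1)])+
        moreover have "i div W = a'" "i mod W = line k' a'" unfolding a'(2) by (rule dv[OF k(2) a'(1)])+
        ultimately show ?thesis using a by metis
      qed
      obtain a where a: "i = a * W + line k a" "line k a = line k' a" using common[OF ij(1)] by blast
      obtain d where d: "j = d * W + line k d" "line k d = line k' d" using common[OF ij(2)] by blast
      have "a = d"
      proof (rule ccontr)
        assume "a \<noteq> d"
        let ?b = "int (k div (B * q))" and ?b' = "int (k' div (B * q))"
        let ?c = "int (k mod (B * q))" and ?c' = "int (k' mod (B * q))"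
        have "?b * int a + ?c = ?b' * int a + ?c'" "?b * int d + ?c = ?b' * int d + ?c'"
          using a(2) d(2) unfolding line_def by (metis of_nat_add of_nat_mult)+
        then have "(?b - ?b') * (int a - int d) = 0" by (simp add: algebra_simps)
        then have b: "?b = ?b'" using \<open>a \<noteq> d\<close> by simp
        then have "?c = ?c'" using \<open>?b * int a + ?c = ?b' * int a + ?c'\<close> by simp
        then have "k = k'" using b by (metis div_mult_mod_eq of_nat_eq_iff)
        then show False using k(3) by simp
      qed
      then show ?thesis using a(1) d(1) by simp
    qed
    moreover have "finite (S k \<inter> S k')" by (simp add: S_def)
    ultimately show ?thesis by (simp add: card_le_Suc0_iff_eq)
  qed
  show ?thesis
  proof
    fix k assume k: "k < B * B * q"
    have "(\<Sum>i\<le>m. (v k i)\<^sup>2) = 1"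
      using inner[OF k, of k] cardS[OF k] q by (simp add: power2_eq_square)
    moreover have "v k i = 0" if "i > m" for i
      using Ssub[OF k] that by (auto simp: v_def)
    ultimately show "v k \<in> topspace (nsphere m)" by (simp add: in_sphere_iff)
    fix k' assume k': "k' < B * B * q" "k \<noteq> k'"
    show "0 \<le> (\<Sum>i\<le>m. v k i * v k' i)" unfolding inner[OF k] by simp
    show "(\<Sum>i\<le>m. v k i * v k' i) \<le> 1 / q"
      unfolding inner[OF k] using meet[OF k k'] by (intro divide_right_mono) auto
  qed
qed

text \<open>
  On a single closed simplex the weak topology is no finer than the product topology.
\<close>

lemma continuous_map_into_geom_realization:
  assumes "\<sigma> \<in> K" and f: "continuous_map X (powertop_real UNIV) f"
    and into: "\<And>x. x \<in> topspace X \<Longrightarrow> f x \<in> closed_simplex \<sigma>"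
  shows "continuous_map X (geom_realization K) f"
  unfolding continuous_map_def
proof (intro conjI allI impI)
  let ?U = "\<Union>\<sigma>\<in>K. closed_simplex \<sigma>"
  have "openin (geom_realization K) ?U"
    unfolding openin_geom_realization
  proof (intro conjI ballI)
    fix \<tau> assume "\<tau> \<in> K"
    then have "?U \<inter> closed_simplex \<tau> = topspace (subtopology (powertop_real UNIV) (closed_simplex \<tau>))" by auto
    then show "openin (subtopology (powertop_real UNIV) (closed_simplex \<tau>)) (?U \<inter> closed_simplex \<tau>)"
      by (metis openin_topspace)
  qed simp
  then show "f \<in> topspace X \<rightarrow> topspace (geom_realization K)"
    using into assms(1) openin_subset by blast
  fix U assume "openin (geom_realization K) U"
  then have op: "openin (subtopology (powertop_real UNIV) (closed_simplex \<sigma>)) (U \<inter> closed_simplex \<sigma>)"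
    using assms(1) by (simp add: openin_geom_realization)
  have "continuous_map X (subtopology (powertop_real UNIV) (closed_simplex \<sigma>)) f"
    using f into by (auto simp: continuous_map_in_subtopology)
  from openin_continuous_map_preimage[OF this op]
  have "openin X {x \<in> topspace X. f x \<in> U \<inter> closed_simplex \<sigma>}" .
  moreover have "{x \<in> topspace X. f x \<in> U \<inter> closed_simplex \<sigma>} = {x \<in> topspace X. f x \<in> U}"
    using into by auto
  ultimately show "openin X {x \<in> topspace X. f x \<in> U}" by simp
qed

lemma antipode_antipode [simp]: "antipode (antipode p) = p"
  by (simp add: antipode_def)

lemma antipode_eq_iff: "antipode p = q \<longleftrightarrow> p = antipode q"
  by (metis antipode_antipode)

text \<open>
  Radial projection to the boundary of the cross-polytope (barycentric coordinates
  \<open>\<bar>x k\<bar> / (\<Sum>k\<le>n. \<bar>x k\<bar>)\<close>), followed by the simplicial map that sends the vertices \<open>\<plusminus> e k\<close> to \<open>\<plusminus> v k\<close>.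
\<close>

definition cross_polytope_map :: "nat \<Rightarrow> (nat \<Rightarrow> nat \<Rightarrow> real) \<Rightarrow> (nat \<Rightarrow> real) \<Rightarrow> (nat \<Rightarrow> real) \<Rightarrow> real" where
  "cross_polytope_map n v x p =
    (\<Sum>k\<le>n. max (x k) 0 * of_bool (p = v k) + max (- x k) 0 * of_bool (p = antipode (v k))) / (\<Sum>k\<le>n. \<bar>x k\<bar>)"

text \<open>
  The image of the face of the cross-polytope whose positive vertices are indexed by \<open>\<sigma>\<close>.
\<close>

definition orthant_simplex :: "nat \<Rightarrow> (nat \<Rightarrow> nat \<Rightarrow> real) \<Rightarrow> nat set \<Rightarrow> (nat \<Rightarrow> real) set" where
  "orthant_simplex n v \<sigma> = v ` \<sigma> \<union> (\<lambda>k. antipode (v k)) ` ({..n} - \<sigma>)"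

lemma cross_polytope_map_odd:
  "cross_polytope_map n v (antipode x) = VR_antipode (cross_polytope_map n v x)"
proof
  fix p
  have "antipode p = antipode q \<longleftrightarrow> p = q" for q by (auto simp: antipode_def fun_eq_iff)
  then show "cross_polytope_map n v (antipode x) p = VR_antipode (cross_polytope_map n v x) p"
    unfolding cross_polytope_map_def VR_antipode_def antipode_eq_iff
    by (simp add: antipode_def[of x] add.commute)
qed

lemma l1_norm_sphere_pos:
  assumes "x \<in> topspace (nsphere n)"
  shows "0 < (\<Sum>k\<le>n. \<bar>x k\<bar>)"
proof (rule ccontr)
  assume "\<not> ?thesis"
  then have "(\<Sum>k\<le>n. \<bar>x k\<bar>) = 0" by (meson abs_ge_zero not_less order_antisym sum_nonneg)
  then have "\<forall>k\<le>n. x k = 0" by (simp add: sum_nonneg_eq_0_iff)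
  then show False using assms by (simp add: in_sphere_iff)
qed

text \<open>
  On the orthant with sign pattern \<open>\<sigma>\<close> only the vertices \<open>v k\<close> with \<open>k \<in> \<sigma>\<close> and the antipodes of
  the others receive weight.
\<close>

lemma cross_polytope_map_in_simplex:
  assumes x: "x \<in> topspace (nsphere n)" and \<sigma>: "\<sigma> \<subseteq> {..n}"
    and sgn: "\<And>k. k \<in> \<sigma> \<Longrightarrow> 0 \<le> x k" "\<And>k. k \<in> {..n} - \<sigma> \<Longrightarrow> x k \<le> 0"
  shows "cross_polytope_map n v x \<in> closed_simplex (orthant_simplex n v \<sigma>)"
proof -
  let ?T = "orthant_simplex n v \<sigma>"
  note pos = l1_norm_sphere_pos[OF x]
  have fin: "finite ?T" using \<sigma> finite_subset by (auto simp: orthant_simplex_def)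
  have "cross_polytope_map n v x p = 0" if "p \<notin> ?T" for p
  proof -
    have "max (x k) 0 * of_bool (p = v k) + max (- x k) 0 * of_bool (p = antipode (v k)) = 0" if "k \<le> n" for k
      using sgn[of k] that \<open>p \<notin> ?T\<close> by (cases "k \<in> \<sigma>") (auto simp: orthant_simplex_def)
    then show ?thesis by (simp add: cross_polytope_map_def)
  qed
  moreover have "sum (cross_polytope_map n v x) ?T = 1"
  proof -
    have "(\<Sum>p\<in>?T. max (x k) 0 * of_bool (p = v k) + max (- x k) 0 * of_bool (p = antipode (v k))) = \<bar>x k\<bar>"
      if "k \<le> n" for k
    proof (cases "k \<in> \<sigma>")
      case True
      then have "v k \<in> ?T" by (auto simp: orthant_simplex_def)
      moreover have "(\<Sum>p\<in>?T. max (x k) 0 * of_bool (p = v k) + max (- x k) 0 * of_bool (p = antipode (v k)))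
          = (\<Sum>p\<in>?T. if p = v k then \<bar>x k\<bar> else 0)"
        using sgn(1)[OF True] by (intro sum.cong) auto
      ultimately show ?thesis using fin by simp
    next
      case False
      then have "antipode (v k) \<in> ?T" using that by (auto simp: orthant_simplex_def)
      moreover have "(\<Sum>p\<in>?T. max (x k) 0 * of_bool (p = v k) + max (- x k) 0 * of_bool (p = antipode (v k)))
          = (\<Sum>p\<in>?T. if p = antipode (v k) then \<bar>x k\<bar> else 0)"
        using sgn(2)[of k] False that by (intro sum.cong) auto
      ultimately show ?thesis using fin by simp
    qed
    then have "(\<Sum>k\<le>n. \<Sum>p\<in>?T. max (x k) 0 * of_bool (p = v k) + max (- x k) 0 * of_bool (p = antipode (v k)))
        = (\<Sum>k\<le>n. \<bar>x k\<bar>)" by simp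
    then show ?thesis using pos unfolding cross_polytope_map_def
      by (simp add: sum.swap[of _ "?T"] flip: sum_divide_distrib)
  qed
  moreover have "0 \<le> cross_polytope_map n v x p" for p
    unfolding cross_polytope_map_def using pos by (intro divide_nonneg_pos sum_nonneg) auto
  ultimately show ?thesis by (simp add: closed_simplex_def)
qed

text \<open>
  Continuity is checked on the finitely many closed orthants, each of which lands in one simplex.
\<close>

lemma odd_map_cross_polytope:
  assumes simp: "\<And>\<sigma>. \<sigma> \<subseteq> {..n} \<Longrightarrow> orthant_simplex n v \<sigma> \<in> VR_complex X d r"
  shows "odd_map n (VR X d r) VR_antipode (cross_polytope_map n v)"
  unfolding odd_map_def
proof (intro conjI ballI)
  let ?f = "cross_polytope_map n v"
  let ?T = "\<lambda>\<sigma>. {x \<in> topspace (nsphere n). (\<forall>k\<in>\<sigma>. x k \<in> {0..}) \<and> (\<forall>k\<in>{..n} - \<sigma>. x k \<in> {..0})}"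
  show "?f (antipode x) = VR_antipode (?f x)" for x by (rule cross_polytope_map_odd)
  have cont: "continuous_map (nsphere n) (powertop_real UNIV) ?f"
    unfolding continuous_map_componentwise_UNIV cross_polytope_map_def
    by (intro allI continuous_map_real_divide continuous_map_sum continuous_map_add
        continuous_map_real_mult continuous_map_real_max continuous_map_minus continuous_map_real_abs
        continuous_map_nsphere_projection)
      (use l1_norm_sphere_pos in \<open>auto simp: less_le\<close>)
  show "continuous_map (nsphere n) (VR X d r) ?f"
  proof (rule pasting_lemma_closed[where I = "Pow {..n}" and T = ?T and f = "\<lambda>_. ?f"])
    fix \<sigma> assume \<sigma>: "\<sigma> \<in> Pow {..n}"
    have halfspaces: "closedin (nsphere n) {x \<in> topspace (nsphere n). \<forall>k\<in>F. x k \<in> A}"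
      if A: "closed A" and F: "finite F" for F and A :: "real set"
      using F
    proof (induction F rule: finite_induct)
      case (insert k F)
      have "closedin (nsphere n) {x \<in> topspace (nsphere n). x k \<in> A}"
        using closedin_continuous_map_preimage[OF continuous_map_nsphere_projection] A by auto
      moreover have "{x \<in> topspace (nsphere n). \<forall>k\<in>insert k F. x k \<in> A}
        = {x \<in> topspace (nsphere n). x k \<in> A} \<inter> {x \<in> topspace (nsphere n). \<forall>k\<in>F. x k \<in> A}" by auto
      ultimately show ?case using insert.IH by auto
    qed simp
    have "?T \<sigma> = {x \<in> topspace (nsphere n). \<forall>k\<in>\<sigma>. x k \<in> {0..}}
        \<inter> {x \<in> topspace (nsphere n). \<forall>k\<in>{..n} - \<sigma>. x k \<in> {..0}}" by blast
    moreover have "finite \<sigma>" using \<sigma> finite_subset by blast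
    ultimately show "closedin (nsphere n) (?T \<sigma>)"
      using halfspaces[of "{0..}" \<sigma>] halfspaces[of "{..0}" "{..n} - \<sigma>"] by (simp add: closedin_Int)
    show "continuous_map (subtopology (nsphere n) (?T \<sigma>)) (VR X d r) ?f"
      unfolding VR_def
    proof (rule continuous_map_into_geom_realization)
      show "orthant_simplex n v \<sigma> \<in> VR_complex X d r" using simp \<sigma> by blast
      show "continuous_map (subtopology (nsphere n) (?T \<sigma>)) (powertop_real UNIV) ?f"
        using cont by (rule continuous_map_from_subtopology)
      fix x assume "x \<in> topspace (subtopology (nsphere n) (?T \<sigma>))"
      then show "?f x \<in> closed_simplex (orthant_simplex n v \<sigma>)"
        using \<sigma> by (intro cross_polytope_map_in_simplex) auto
    qed
  next
    fix x assume "x \<in> topspace (nsphere n)"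
    then show "\<exists>j. j \<in> Pow {..n} \<and> x \<in> ?T j \<and> ?f x = ?f x"
      by (intro exI[of _ "{k. k \<le> n \<and> 0 \<le> x k}"]) auto
  qed simp_all
qed

text \<open>
  A simplex of the cross-polytope never contains an antipodal pair, so all its angles are at most the
  one with cosine \<open>- 1 / q\<close>.
\<close>

lemma c_VR_le_arccos:
  assumes q: "0 < q" and B: "0 < B" and dim: "2 * B * q * q \<le> Suc m" and n: "n < B * B * q"
  shows "c_VR m n \<le> arccos (- (1 / q))"
proof -
  obtain v :: "nat \<Rightarrow> nat \<Rightarrow> real" where v:
    "\<And>k. k < B * B * q \<Longrightarrow> v k \<in> topspace (nsphere m)"
    "\<And>k k'. k < B * B * q \<Longrightarrow> k' < B * B * q \<Longrightarrow> k \<noteq> k' \<Longrightarrow> 0 \<le> (\<Sum>i\<le>m. v k i * v k' i)"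
    "\<And>k k'. k < B * B * q \<Longrightarrow> k' < B * B * q \<Longrightarrow> k \<noteq> k' \<Longrightarrow> (\<Sum>i\<le>m. v k i * v k' i) \<le> 1 / q"
    using nearly_orthogonal_vectors[OF q B dim] by blast
  have vn: "k < B * B * q" if "k \<le> n" for k using that n by simp
  let ?r = "arccos (- (1 / q))"
  have q1: "0 \<le> 1 / real q" "1 / real q \<le> 1" using q by auto
  have r: "0 \<le> ?r" by (intro arccos_lbound) (use q1 in linarith)+
  have anti: "antipode x \<in> topspace (nsphere m)" if "x \<in> topspace (nsphere m)" for x
    using that by (simp add: in_sphere_iff antipode_def)
  have dist_le: "sphere_dist m x y \<le> ?r"
    if "- (1 / q) \<le> (\<Sum>i\<le>m. x i * y i)" "(\<Sum>i\<le>m. x i * y i) \<le> 1" for x y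
    unfolding sphere_dist_def using that q1 by (intro arccos_le_arccos) linarith+
  have "orthant_simplex n v \<sigma> \<in> VR_complex (topspace (nsphere m)) (sphere_dist m) ?r"
    if \<sigma>: "\<sigma> \<subseteq> {..n}" for \<sigma>
  proof -
    define s where "s k = (if k \<in> \<sigma> then 1 else - 1 :: real)" for k
    have os: "orthant_simplex n v \<sigma> = (\<lambda>k i. s k * v k i) ` {..n}"
    proof -
      have "{..n} = \<sigma> \<union> ({..n} - \<sigma>)" using \<sigma> by blast
      then have "(\<lambda>k i. s k * v k i) ` {..n} = (\<lambda>k i. s k * v k i) ` \<sigma> \<union> (\<lambda>k i. s k * v k i) ` ({..n} - \<sigma>)"
        by (metis image_Un)
      also have "(\<lambda>k i. s k * v k i) ` \<sigma> = v ` \<sigma>"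
        by (intro image_cong) (auto simp: s_def)
      also have "(\<lambda>k i. s k * v k i) ` ({..n} - \<sigma>) = (\<lambda>k. antipode (v k)) ` ({..n} - \<sigma>)"
        by (intro image_cong) (auto simp: s_def antipode_def)
      finally show ?thesis by (simp add: orthant_simplex_def)
    qed
    have "sphere_dist m (\<lambda>i. s k * v k i) (\<lambda>i. s k' * v k' i) \<le> ?r" if k: "k \<le> n" "k' \<le> n" for k k'
    proof -
      have eq: "(\<Sum>i\<le>m. s k * v k i * (s k' * v k' i)) = s k * s k' * (\<Sum>i\<le>m. v k i * v k' i)"
        unfolding sum_distrib_left by (rule sum.cong) (simp_all only: ac_simps)
      show ?thesis
      proof (cases "k = k'")
        case True
        have "(\<Sum>i\<le>m. v k i * v k i) = 1" using v(1)[OF vn[OF k(1)]] by (simp add: in_sphere_iff power2_eq_square)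
        moreover have "- 1 \<le> 1 / real q" using q1(1) by linarith
        ultimately show ?thesis using True by (intro dist_le) (auto simp: eq s_def)
      next
        case False
        define P where "P = (\<Sum>i\<le>m. v k i * v k' i)"
        have P: "0 \<le> P" "P \<le> 1 / q" using v(2,3)[OF vn[OF k(1)] vn[OF k(2)] False] by (auto simp: P_def)
        have "s k * s k' = 1 \<or> s k * s k' = - 1" by (auto simp: s_def)
        then have "- (1 / real q) \<le> s k * s k' * P" "s k * s k' * P \<le> 1" using P q1 by auto
        then show ?thesis by (intro dist_le) (simp_all only: eq P_def)
      qed
    qed
    moreover have "(\<lambda>i. s k * v k i) \<in> topspace (nsphere m)" if "k \<le> n" for k
      using v(1)[OF vn[OF that]] by (auto simp: in_sphere_iff s_def)
    ultimately show ?thesis unfolding os VR_complex_def by auto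
  qed
  then have "odd_map n (sphere_VR m ?r) VR_antipode (cross_polytope_map n v)"
    unfolding sphere_VR_def by (rule odd_map_cross_polytope)
  then have "enat n \<le> coind (sphere_VR m ?r) VR_antipode"
    unfolding coind_def by (intro Sup_upper) blast
  then show ?thesis unfolding c_VR_def using r by (intro cInf_lower bdd_belowI[of _ 0]) auto
qed

text \<open>
  For fixed \<open>q\<close> the number \<open>B * B * q\<close> of available vectors grows quadratically in the dimension, hence
  eventually exceeds \<open>n\<close>.
\<close>

lemma c_VR_asymptotic_upper_bound:
  fixes m n :: "nat \<Rightarrow> nat" and l :: real
  assumes m: "filterlim m at_top sequentially"
    and nm: "(\<lambda>j. real (n j) / real (m j)) \<longlonglongrightarrow> l" and "0 < e"
  shows "\<forall>\<^sub>F j in sequentially. c_VR (m j) (n j) \<le> pi / 2 + e"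
proof -
  have "(\<lambda>q. arccos (- (1 / real (Suc q)))) \<longlonglongrightarrow> arccos (- 0)"
    by (intro isCont_tendsto_compose[OF isCont_arccos] tendsto_minus LIMSEQ_Suc lim_1_over_n) auto
  then have "\<forall>\<^sub>F q in sequentially. arccos (- (1 / real (Suc q))) < pi / 2 + e"
    using \<open>0 < e\<close> by (intro order_tendstoD(2)) auto
  then obtain q' where "arccos (- (1 / real (Suc q'))) < pi / 2 + e"
    using eventually_happens'[OF sequentially_bot] by blast
  then obtain q :: nat where q: "0 < q" "arccos (- (1 / real q)) < pi / 2 + e" by blast
  define B where "B j = Suc (m j) div (2 * q * q)" for j
  have qq: "0 < 2 * q * q" using q by simp
  define K where "K = nat \<lceil>\<bar>l\<bar> + 1\<rceil>"
  have "\<forall>\<^sub>F j in sequentially. real (n j) / real (m j) < \<bar>l\<bar> + 1"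
    using nm by (intro order_tendstoD(2)) auto
  moreover have "\<forall>\<^sub>F j in sequentially. 1 \<le> m j"
    using m unfolding filterlim_at_top by blast
  moreover have "\<forall>\<^sub>F j in sequentially. (K * 4 * q + 1) * (2 * q * q) \<le> m j"
    using m unfolding filterlim_at_top by blast
  ultimately show ?thesis
  proof eventually_elim
    case (elim j)
    have "real (n j) < (\<bar>l\<bar> + 1) * real (m j)" using elim(1,2) by (simp add: field_simps)
    also have "\<dots> \<le> real K * real (m j)" unfolding K_def by (intro mult_right_mono) linarith+
    finally have nK: "n j < K * m j" by (simp flip: of_nat_mult)
    have Bge: "K * 4 * q + 1 \<le> B j"
    proof -
      have "(K * 4 * q + 1) * (2 * q * q) div (2 * q * q) \<le> B j"
        unfolding B_def using elim(3) by (intro div_le_mono) linarith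
      then show ?thesis using qq by simp
    qed
    have dim: "2 * B j * q * q \<le> Suc (m j)"
      using div_times_less_eq_dividend[of "Suc (m j)" "2 * q * q"] unfolding B_def[symmetric] by (simp add: ac_simps)
    have "Suc (m j) = B j * (2 * q * q) + Suc (m j) mod (2 * q * q)" by (simp only: B_def div_mult_mod_eq)
    moreover have "Suc (m j) mod (2 * q * q) < 2 * q * q" using qq by simp
    ultimately have "m j \<le> B j * (2 * q * q) + 1 * (2 * q * q)" by simp
    also have "\<dots> \<le> B j * (2 * q * q) + B j * (2 * q * q)"
      using Bge by (intro add_left_mono mult_le_mono) auto
    finally have "m j \<le> B j * (4 * q * q)" by (simp add: algebra_simps)
    then have "K * m j \<le> K * (B j * (4 * q * q))" by simp
    also have "\<dots> = (K * 4 * q) * (B j * q)" by (simp add: ac_simps)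
    also have "\<dots> \<le> B j * (B j * q)" using Bge by (intro mult_le_mono) auto
    finally have "n j < B j * B j * q" using nK by (simp add: ac_simps)
    then show ?case using c_VR_le_arccos[OF q(1) _ dim] q(2) Bge by force
  qed
qed

section \<open>The function Phi and its threshold\<close>

lemma sin_powr_bounds:
  assumes "0 \<le> x" "x \<le> pi / 2" "0 \<le> l"
  shows "0 \<le> sin x powr l" "sin x powr l \<le> 1"
proof -
  have "0 \<le> sin x" using assms by (intro sin_ge_zero) auto
  then show "0 \<le> sin x powr l" "sin x powr l \<le> 1"
    using assms(3) by (auto intro: powr_le1)
qed

text \<open>
  The function of \<open>x\<close> extends continuously to \<open>[0, pi / 2]\<close> with value \<open>0\<close> at both ends and is positive
  at \<open>1\<close>, so its maximum is attained in the interior.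
\<close>

lemma Phi_chi_attained:
  assumes l: "l > 1"
  obtains x where "0 < x" "x < pi / 2" "Phi_chi l = x - arcsin (sin x powr l)"
    "\<And>z. 0 < z \<Longrightarrow> z < pi / 2 \<Longrightarrow> z - arcsin (sin z powr l) \<le> Phi_chi l"
proof -
  let ?g = "\<lambda>x. x - arcsin (sin x powr l)"
  have "continuous_on {0..pi / 2} ?g"
    using sin_powr_bounds[of _ l] l
    by (intro continuous_on_diff continuous_on_id continuous_on_arcsin continuous_on_powr'
        continuous_on_sin continuous_on_const) (auto intro: sin_ge_zero order_trans[OF _ powr_ge_zero])
  then obtain x where x: "x \<in> {0..pi / 2}" "\<And>z. z \<in> {0..pi / 2} \<Longrightarrow> ?g z \<le> ?g x"
    using continuous_attains_sup[of "{0..pi / 2}" ?g] by auto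
  have one: "1 < pi / 2" using pi_gt3 by simp
  have "sin 1 powr l < sin 1 powr 1"
    using sin_in_unit_interval[OF _ one] l by (intro powr_less_mono') auto
  then have "sin 1 powr l < sin 1" using sin_in_unit_interval[OF _ one] by simp
  then have "arcsin (sin 1 powr l) < arcsin (sin 1)"
    by (intro arcsin_less_arcsin) (auto intro: order_trans[OF _ powr_ge_zero])
  then have "0 < ?g 1" using one by (simp add: arcsin_sin)
  then have pos: "0 < ?g x" using x(2)[of 1] one by simp
  have x0: "0 < x" "x < pi / 2"
  proof -
    have "?g 0 = 0" "?g (pi / 2) = 0" by auto
    then have "x \<noteq> 0" "x \<noteq> pi / 2" using pos by (metis less_irrefl)+
    then show "0 < x" "x < pi / 2" using x(1) by auto
  qed
  have "Phi_chi l = ?g x"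
    unfolding Phi_chi_def using x x0 by (intro Greatest_equality) auto
  then show ?thesis using that[OF x0] x(2) by auto
qed

lemma Phi_chi_gt_iff:
  assumes "l > 1"
  shows "c < Phi_chi l \<longleftrightarrow> (\<exists>x. 0 < x \<and> x < pi / 2 \<and> c < x - arcsin (sin x powr l))"
proof -
  obtain x where "0 < x" "x < pi / 2" "Phi_chi l = x - arcsin (sin x powr l)"
    "\<And>z. 0 < z \<Longrightarrow> z < pi / 2 \<Longrightarrow> z - arcsin (sin z powr l) \<le> Phi_chi l"
    using Phi_chi_attained[OF assms] by blast
  then show ?thesis by (metis less_le_trans)
qed

text \<open>
  For \<open>x \<ge> pi / 4\<close> one has \<open>sin (x - pi / 4) = (sin x - cos x) / sqrt 2 \<le> sin x ^ 2\<close>, since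
  \<open>1 / sqrt 2 \<le> sin x\<close>.
\<close>

lemma Phi_chi_2_le: "Phi_chi 2 \<le> pi / 4"
proof (rule ccontr)
  assume "\<not> ?thesis"
  then obtain x where x: "0 < x" "x < pi / 2" and gt: "pi / 4 < x - arcsin (sin x powr 2)"
    using Phi_chi_gt_iff[of 2 "pi / 4"] by auto
  have s: "0 < sin x" "sin x < 1" using sin_in_unit_interval[OF x] by auto
  have "0 \<le> arcsin ((sin x)\<^sup>2)" using s by (intro arcsin_nonneg) (auto simp: power_le_one)
  then have x4: "pi / 4 < x" using gt s by simp
  have "sin (pi / 4) \<le> sin x" using x x4 by (intro sin_mono_le_eq[THEN iffD2]) auto
  then have r: "sqrt 2 / 2 \<le> sin x" by (simp add: sin_45)
  have "sin (x - pi / 4) = (sin x - cos x) * (sqrt 2 / 2)"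
    by (simp add: sin_diff sin_45 cos_45 algebra_simps)
  also have "\<dots> \<le> sin x * sin x"
    using s r cos_gt_zero[of x] x by (intro mult_mono) auto
  finally have "arcsin (sin (x - pi / 4)) \<le> arcsin ((sin x)\<^sup>2)"
    using s by (intro arcsin_le_arcsin) (auto simp: power2_eq_square power_le_one mult_le_one)
  moreover have "arcsin (sin (x - pi / 4)) = x - pi / 4" using x x4 by (intro arcsin_sin) auto
  ultimately show False using gt s by simp
qed

text \<open>
  At \<open>sin x = 4 / 5\<close> one has \<open>sin (x - pi / 4) = sqrt 2 / 10\<close>, slightly more than \<open>(4 / 5) ^ 9\<close>.
\<close>

lemma Phi_chi_9_gt: "pi / 4 < Phi_chi 9"
proof -
  define x where "x = arcsin (4 / 5 :: real)"
  have sx: "sin x = 4 / 5" by (simp add: x_def)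
  have cx: "cos x = 3 / 5"
  proof -
    have "cos x = sqrt (1 - (4 / 5)\<^sup>2)" unfolding x_def by (intro cos_arcsin) auto
    also have "\<dots> = sqrt ((3 / 5)\<^sup>2)" by (simp add: power2_eq_square)
    finally show ?thesis by simp
  qed
  have x: "0 < x" "x < pi / 2"
    using arcsin_less_arcsin[of 0 "4 / 5"] arcsin_less_arcsin[of "4 / 5" 1] by (auto simp: x_def)
  have "(4 / 5 :: real) ^ 9 < sqrt 2 / 10"
  proof (rule power2_less_imp_less)
    show "((4 / 5 :: real) ^ 9)\<^sup>2 < (sqrt 2 / 10)\<^sup>2" by (simp add: power_divide)
  qed simp
  also have "sqrt 2 / 10 = sin (x - pi / 4)"
    by (simp add: sin_diff sin_45 cos_45 sx cx)
  finally have "arcsin ((4 / 5) ^ 9) < arcsin (sin (x - pi / 4))"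
    by (intro arcsin_less_arcsin) (auto intro: order_trans[of _ 0])
  also have "\<dots> = x - pi / 4" using x by (intro arcsin_sin) auto
  finally have "pi / 4 < x - arcsin (sin x powr 9)" by (simp add: sx)
  then show ?thesis using x by (subst Phi_chi_gt_iff) auto
qed

lemma Phi_chi_threshold_mono:
  assumes "1 < l" "l \<le> l'" "c < Phi_chi l"
  shows "c < Phi_chi l'"
proof -
  obtain x where x: "0 < x" "x < pi / 2" "c < x - arcsin (sin x powr l)"
    using Phi_chi_gt_iff[of l c] assms by blast
  have "sin x powr l' \<le> sin x powr l"
    using sin_in_unit_interval[OF x(1,2)] assms by (intro powr_mono') auto
  then have "arcsin (sin x powr l') \<le> arcsin (sin x powr l)"
    using sin_powr_bounds[of x l] x assms(1)
    by (intro arcsin_le_arcsin) (auto intro: order_trans[OF _ powr_ge_zero])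
  then have "c < x - arcsin (sin x powr l')" using x(3) by linarith
  then show ?thesis using Phi_chi_gt_iff[of l' c] assms(1,2) x by auto
qed

lemma Phi_chi_threshold_open:
  assumes "1 < l" "c < Phi_chi l"
  obtains l' where "1 < l'" "l' < l" "c < Phi_chi l'"
proof -
  obtain x where x: "0 < x" "x < pi / 2" "c < x - arcsin (sin x powr l)"
    using Phi_chi_gt_iff[of l c] assms by blast
  have s: "0 < sin x" "sin x < 1" using sin_in_unit_interval[OF x(1,2)] by auto
  have lt: "sin x powr l < 1" using powr_less_mono'[of "sin x" 0 l] s assms(1) by simp
  have "((\<lambda>k. x - arcsin (sin x powr k)) \<longlongrightarrow> x - arcsin (sin x powr l)) (at_left l)"
    using s lt powr_ge_zero[of "sin x" l]
    by (intro tendsto_intros isCont_tendsto_compose[OF isCont_arcsin]) (auto intro: less_le_trans[of _ 0])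
  then have "\<forall>\<^sub>F k in at_left l. c < x - arcsin (sin x powr k)"
    using x(3) by (intro order_tendstoD(1))
  moreover have "\<forall>\<^sub>F k in at_left l. 1 < k \<and> k < l"
    using eventually_at_left_real[OF assms(1)] by simp
  ultimately have "\<forall>\<^sub>F k in at_left l. 1 < k \<and> k < l \<and> c < x - arcsin (sin x powr k)"
    by eventually_elim auto
  then obtain k where "1 < k" "k < l" "c < x - arcsin (sin x powr k)"
    using eventually_happens'[of "at_left l"] by (auto simp: trivial_limit_at_left_real)
  then show ?thesis using that[of k] Phi_chi_gt_iff[of k c] x by blast
qed

text \<open>
  The exponents with \<open>Phi_chi\<close> above \<open>pi / 4\<close> form an open up-set that contains \<open>9\<close> and lies above
  \<open>2\<close>, so its infimum is the threshold; uniqueness is needed for the definite description.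
\<close>

lemma lambda_star_threshold: "1 < lambda_star \<and> (\<forall>l>1. Phi_chi l > pi / 4 \<longleftrightarrow> l > lambda_star)"
  unfolding lambda_star_def
proof (rule theI')
  define A where "A = {l. 1 < l \<and> pi / 4 < Phi_chi l}"
  have two: "2 < l" if "l \<in> A" for l
    using that Phi_chi_threshold_mono[of l 2 "pi / 4"] Phi_chi_2_le by (force simp: A_def)
  then have bdd: "bdd_below A" by (intro bdd_belowI[of _ 2]) (use less_imp_le in blast)
  have nine: "9 \<in> A" using Phi_chi_9_gt by (simp add: A_def)
  have iff: "pi / 4 < Phi_chi l \<longleftrightarrow> Inf A < l" if "1 < l" for l
  proof
    assume "pi / 4 < Phi_chi l"
    then obtain l' where "1 < l'" "l' < l" "pi / 4 < Phi_chi l'" using Phi_chi_threshold_open \<open>1 < l\<close> by blast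
    then show "Inf A < l" using cInf_lower[OF _ bdd, of l'] by (simp add: A_def)
  next
    assume "Inf A < l"
    then obtain l' where "l' \<in> A" "l' < l" using cInf_lessD[of A l] nine by blast
    then show "pi / 4 < Phi_chi l" using Phi_chi_threshold_mono[of l' l "pi / 4"] by (simp add: A_def)
  qed
  have ge2: "2 \<le> Inf A" using nine two by (intro cInf_greatest) (auto intro: less_imp_le)
  show "\<exists>!s. 1 < s \<and> (\<forall>l>1. Phi_chi l > pi / 4 \<longleftrightarrow> l > s)"
  proof (rule ex1I[of _ "Inf A"])
    show "1 < Inf A \<and> (\<forall>l>1. Phi_chi l > pi / 4 \<longleftrightarrow> l > Inf A)" using iff ge2 by auto
    fix s :: real assume s: "1 < s \<and> (\<forall>l>1. Phi_chi l > pi / 4 \<longleftrightarrow> l > s)"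
    then have same: "s < l \<longleftrightarrow> Inf A < l" if "1 < l" for l using iff that by blast
    show "s = Inf A"
    proof (rule ccontr)
      assume "s \<noteq> Inf A"
      then consider "s < Inf A" | "Inf A < s" by linarith
      then show False
      proof cases
        case 1 then show False using same[of "Inf A"] ge2 by simp
      next
        case 2 then show False using same[of s] s by simp
      qed
    qed
  qed
qed

lemma sphere_GH_dist_asymptotic_lower_bound:
  fixes m n :: "nat \<Rightarrow> nat" and l :: real
  assumes "filterlim m at_top sequentially" "l > 1"
    and "(\<lambda>j. real (n j) / real (m j)) \<longlonglongrightarrow> l" and "0 < d"
  shows "\<forall>\<^sub>F j in sequentially. Phi_chi l - d \<le> sphere_GH_dist (m j) (n j)"
proof -
  obtain x where x: "0 < x" "x < pi / 2" and Phi: "Phi_chi l = x - arcsin (sin x powr l)"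
    using Phi_chi_attained[OF assms(2)] by blast
  define y0 where "y0 = arcsin (sin x powr l)"
  have s: "0 < sin x" "sin x < 1" using sin_in_unit_interval[OF x] by auto
  have p: "0 < sin x powr l" "sin x powr l < 1"
    using powr_less_mono'[of "sin x" 0 l] s assms(2) by auto
  have y0: "0 < y0" "y0 < pi / 2" "sin y0 = sin x powr l"
    unfolding y0_def using p order_trans[of "- 1" 0 "sin x powr l"] arcsin_less_arcsin[of 0 "sin x powr l"] arcsin_less_arcsin[of "sin x powr l" 1]
    by auto
  define y where "y = min (y0 + d) ((y0 + pi / 2) / 2)"
  have y: "y0 < y" "y < pi / 2" "y \<le> y0 + d"
  proof -
    have "y \<le> (y0 + pi / 2) / 2" unfolding y_def by (rule min.cobounded2)
    then show "y < pi / 2" using y0(2) by simp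
  qed (use y0 \<open>0 < d\<close> in \<open>auto simp: y_def\<close>)
  have "sin y0 < sin y" using y y0 by (intro sin_monotone_2pi) auto
  then have "\<forall>\<^sub>F j in sequentially. x - y \<le> sphere_GH_dist (m j) (n j)"
    using sphere_GH_dist_eventually_ge[OF assms(1,2,3) x _ y(2)] y y0 by simp
  then show ?thesis by eventually_elim (use Phi y in \<open>simp add: y0_def\<close>)
qed

lemma le_liminf_ereal:
  fixes f :: "nat \<Rightarrow> real"
  assumes "\<And>d. 0 < d \<Longrightarrow> \<forall>\<^sub>F j in sequentially. c - d \<le> f j"
  shows "ereal c \<le> liminf (\<lambda>j. ereal (f j))"
  unfolding le_Liminf_iff
proof (intro allI impI)
  fix y assume "y < ereal c"
  then obtain r where r: "y < ereal r" "r < c" using ereal_dense2 by (metis ereal_less(1) less_ereal.simps(1))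
  have "\<forall>\<^sub>F j in sequentially. c - (c - r) \<le> f j" using r by (intro assms) simp
  then show "\<forall>\<^sub>F j in sequentially. y < ereal (f j)"
    by eventually_elim (use r(1) less_le_trans in fastforce)
qed

theorem mainTheorem5:
  fixes m n :: "nat \<Rightarrow> nat" and l :: real
  assumes "\<And>j. m j < n j"
    and "filterlim m at_top sequentially"
    and "l > 1"
    and "(\<lambda>j. real (n j) / real (m j)) \<longlonglongrightarrow> l"
  shows "liminf (\<lambda>j. ereal (sphere_GH_dist (m j) (n j))) \<ge> ereal (Phi_chi l)
    \<and> (l > lambda_star \<longrightarrow>
         liminf (\<lambda>j. ereal (sphere_GH_dist (m j) (n j) - 1 / 2 * c_VR (m j) (n j)))
           \<ge> ereal (Phi_chi l - pi / 4)
         \<and> Phi_chi l - pi / 4 > 0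
         \<and> (\<forall>\<^sub>F j in sequentially. 1 / 2 * c_VR (m j) (n j) < sphere_GH_dist (m j) (n j)))
    \<and> (l \<ge> 9 \<longrightarrow> l > lambda_star)"
proof (intro conjI impI)
  note GH = sphere_GH_dist_asymptotic_lower_bound[OF assms(2,3,4)]
  show "ereal (Phi_chi l) \<le> liminf (\<lambda>j. ereal (sphere_GH_dist (m j) (n j)))"
    using GH by (rule le_liminf_ereal)
  have diff: "\<forall>\<^sub>F j in sequentially. Phi_chi l - pi / 4 - d \<le> sphere_GH_dist (m j) (n j) - 1 / 2 * c_VR (m j) (n j)"
    if "0 < d" for d
  proof -
    have "\<forall>\<^sub>F j in sequentially. Phi_chi l - d / 2 \<le> sphere_GH_dist (m j) (n j)"
      using that by (intro GH) simp
    moreover have "\<forall>\<^sub>F j in sequentially. c_VR (m j) (n j) \<le> pi / 2 + d"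
      using that by (intro c_VR_asymptotic_upper_bound[OF assms(2,4)])
    ultimately show ?thesis by eventually_elim (simp add: field_simps)
  qed
  show "ereal (Phi_chi l - pi / 4) \<le> liminf (\<lambda>j. ereal (sphere_GH_dist (m j) (n j) - 1 / 2 * c_VR (m j) (n j)))"
    using diff by (rule le_liminf_ereal)
  {
    assume "l > lambda_star"
    then show pos: "Phi_chi l - pi / 4 > 0" using lambda_star_threshold assms(3) by auto
    have "\<forall>\<^sub>F j in sequentially. Phi_chi l - pi / 4 - (Phi_chi l - pi / 4) / 2
        \<le> sphere_GH_dist (m j) (n j) - 1 / 2 * c_VR (m j) (n j)"
      using pos by (intro diff) simp
    then show "\<forall>\<^sub>F j in sequentially. 1 / 2 * c_VR (m j) (n j) < sphere_GH_dist (m j) (n j)"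
    proof eventually_elim
      case (elim j)
      then show ?case using pos by (simp add: field_simps)
    qed
  }
  assume "l \<ge> 9"
  then have "pi / 4 < Phi_chi l" using Phi_chi_threshold_mono[of 9 l "pi / 4"] Phi_chi_9_gt by simp
  then show "l > lambda_star" using lambda_star_threshold assms(3) by blast
qed

end
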